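(* Let $n_A,n_B\ge 0$ be integers, $\mathcal{H}_A=(\mathbb{C}^2)^{\otimes n_A}$, $\mathcal{H}_B=(\mathbb{C}^2)^{\otimes n_B}$, and let $\mathcal{H}_E$ be a Hilbert space. For every unitary $U$ acting on $\mathcal{H}_A\otimes\mathcal{H}_B$ and for every $\varepsilon>0$, given sufficiently many (but finitely many) EPR pairs shared between Alice and Bob, there exist local operations $\mathcal{A}$ and $\mathcal{B}$, acting on Alice's and Bob's respective sides (that is, $\mathcal{A}$ acts on $A$ and on Alice's halves of the EPR pairs, $\mathcal{B}$ acts on $B$ and on Bob's halves; no communication takes place), with the following property. For any initial state $|\psi\rangle\in\mathcal{H}_A\otimes\mathcal{H}_B\otimes\mathcal{H}_E$ (with Alice holding $A$ and Bob holding $B$), the joint execution $\mathcal{A}\otimes\mathcal{B}$ transforms $|\psi\rangle$ into a state $|\varphi'\rangle$ and provides classical outputs $k$ to Alice and $\ell$ to Bob, such that the following holds except with probability $\varepsilon$: the state $|\varphi'\rangle$ coincides with $|\varphi\rangle=(U\otimes\mathbb{I})|\psi\rangle$ up to local qubit-wise operations on $A$ and $B$ that are determined by $k$ and $\ell$.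
   Context: An EPR pair is the two-qubit state $(|0\rangle|0\rangle+|1\rangle|1\rangle)/\sqrt2$, one qubit held by Alice and the other by Bob. $\mathbb{I}$ is the identity on $\mathcal{H}_E$. The number of EPR pairs and the operations $\mathcal{A},\mathcal{B}$ may depend on $U$ and $\varepsilon$ but not on the (arbitrary, unknown) state $|\psi\rangle$. "$|\varphi'\rangle$ coincides with $|\varphi\rangle$ up to local qubit-wise operations on $A$ and $B$ determined by $k$ and $\ell$" means that $|\varphi\rangle=(V^A_{k,\ell}\otimes V^B_{k,\ell}\otimes\mathbb{I})|\varphi'\rangle$, where $\{V^A_{k,\ell}\}_{k,\ell}$ and $\{V^B_{k,\ell}\}_{k,\ell}$ are fixed families of unitaries (independent of $|\psi\rangle$) which act qubit-wise, i.e. are tensor products of one-qubit unitaries, on $\mathcal{H}_A$ and $\mathcal{H}_B$ respectively. After the execution, "$A$" and "$B$" denote the $n_A$-qubit and $n_B$-qubit output registers held by Alice and by Bob, respectively. *)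

theory Defs
  imports Complex_Main "Jordan_Normal_Form.Schur_Decomposition"
begin

subsection \<open>Complex Hilbert spaces\<close>

text \<open>The inner product is antilinear in its first argument. The last axiom yields positivity and
definiteness of the inner product; completeness comes from \<^class>\<open>banach\<close>.\<close>

class complex_hilbert = banach +
  fixes scaleC :: "complex \<Rightarrow> 'a \<Rightarrow> 'a"  (infixr "*\<^sub>C" 75)
    and cinner :: "'a \<Rightarrow> 'a \<Rightarrow> complex"
  assumes scaleC_add_right: "a *\<^sub>C (x + y) = a *\<^sub>C x + a *\<^sub>C y"
    and scaleC_add_left: "(a + b) *\<^sub>C x = a *\<^sub>C x + b *\<^sub>C x"
    and scaleC_scaleC: "a *\<^sub>C (b *\<^sub>C x) = (a * b) *\<^sub>C x"
    and scaleC_of_real: "complex_of_real r *\<^sub>C x = r *\<^sub>R x"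
    and cinner_commute: "cinner x y = cnj (cinner y x)"
    and cinner_add_right: "cinner x (y + z) = cinner x y + cinner x z"
    and cinner_scaleC_right: "cinner x (a *\<^sub>C y) = a * cinner x y"
    and cinner_self: "cinner x x = complex_of_real ((norm x)\<^sup>2)"

instantiation complex :: complex_hilbert
begin

definition scaleC_complex :: "complex \<Rightarrow> complex \<Rightarrow> complex" where
  "scaleC_complex a x = a * x"

definition cinner_complex :: "complex \<Rightarrow> complex \<Rightarrow> complex" where
  "cinner_complex x y = cnj x * y"

instance
  by standard
    (simp_all add: scaleC_complex_def cinner_complex_def algebra_simps scaleR_conv_of_real
      complex_norm_square[symmetric] mult.commute del: of_real_power)

end

subsection \<open>Finite-dimensional operators\<close>

text \<open>The standard basis of \<open>n\<close> qubits is indexed by the numbers below \<open>2 ^ n\<close>; the basis vector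
\<open>i \<otimes> j\<close> of a tensor product with second factor of dimension \<open>d\<close> has index \<open>i * d + j\<close>.\<close>

definition unitary_mat :: "nat \<Rightarrow> complex mat \<Rightarrow> bool" where
  "unitary_mat d U \<longleftrightarrow>
     U \<in> carrier_mat d d \<and> mat_adjoint U * U = 1\<^sub>m d \<and> U * mat_adjoint U = 1\<^sub>m d"

definition kron :: "complex mat \<Rightarrow> complex mat \<Rightarrow> complex mat" where
  "kron P Q = mat (dim_row P * dim_row Q) (dim_col P * dim_col Q)
     (\<lambda>(i, j). P $$ (i div dim_row Q, j div dim_col Q) * Q $$ (i mod dim_row Q, j mod dim_col Q))"

definition qubitwise_unitary :: "nat \<Rightarrow> complex mat \<Rightarrow> bool" where
  "qubitwise_unitary n V \<longleftrightarrow>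
     (\<exists>vs. length vs = n \<and> (\<forall>v \<in> set vs. unitary_mat 2 v) \<and> V = foldr kron vs (1\<^sub>m 1))"

subsection \<open>States\<close>

text \<open>A vector of \<open>\<complex>\<^sup>d \<otimes> \<H>\<^sub>E\<close> is represented as the \<open>d\<close>-tuple of its \<open>\<H>\<^sub>E\<close>-components
with respect to the standard basis of the first factor, and \<open>act T\<close> is \<open>T \<otimes> \<I>\<close>.\<close>

definition state_norm :: "'e::complex_hilbert vec \<Rightarrow> real" where
  "state_norm \<psi> = sqrt (\<Sum>i<dim_vec \<psi>. (norm (\<psi> $ i))\<^sup>2)"

definition is_state :: "nat \<Rightarrow> 'e::complex_hilbert vec \<Rightarrow> bool" where
  "is_state d \<psi> \<longleftrightarrow> \<psi> \<in> carrier_vec d \<and> state_norm \<psi> = 1"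

definition act :: "complex mat \<Rightarrow> 'e::complex_hilbert vec \<Rightarrow> 'e vec" where
  "act T \<psi> = vec (dim_row T) (\<lambda>i. \<Sum>j<dim_col T. T $$ (i, j) *\<^sub>C \<psi> $ j)"

definition epr_pair :: "bool \<Rightarrow> bool \<Rightarrow> complex" where
  "epr_pair a b = (if a = b then complex_of_real (1 / sqrt 2) else 0)"

text \<open>The amplitude of \<open>m\<close> EPR pairs when Alice's halves are in basis state \<open>x\<close> and Bob's halves
are in basis state \<open>y\<close>.\<close>

definition epr_pairs :: "nat \<Rightarrow> nat \<Rightarrow> nat \<Rightarrow> complex" where
  "epr_pairs m x y = (\<Prod>i<m. epr_pair (bit x i) (bit y i))"

text \<open>The state \<open>\<psi>\<close> together with \<open>m\<close> EPR pairs, with the tensor factors in the order \<open>A\<close>, Alice's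
halves, \<open>B\<close>, Bob's halves, \<open>E\<close>: the index \<open>p\<close> belongs to Alice and \<open>q\<close> to Bob.\<close>

definition with_epr_pairs :: "nat \<Rightarrow> nat \<Rightarrow> nat \<Rightarrow> 'e::complex_hilbert vec \<Rightarrow> 'e vec" where
  "with_epr_pairs nA nB m \<psi> = vec ((2 ^ nA * 2 ^ m) * (2 ^ nB * 2 ^ m)) (\<lambda>i.
     let p = i div (2 ^ nB * 2 ^ m); q = i mod (2 ^ nB * 2 ^ m)
     in epr_pairs m (p mod 2 ^ m) (q mod 2 ^ m) *\<^sub>C \<psi> $ ((p div 2 ^ m) * 2 ^ nB + q div 2 ^ m))"

subsection \<open>Local operations\<close>

text \<open>A quantum operation on an \<open>n\<close>-qubit register and \<open>m\<close> halves of EPR pairs whose output is an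
\<open>n\<close>-qubit register and a classical value \<open>k < K\<close>. It has one Kraus operator \<open>M k\<close> per classical
value, so that the post-measurement states are pure whenever the input is; a coarser instrument
is obtained by forgetting part of \<open>k\<close>.\<close>

definition local_operation :: "nat \<Rightarrow> nat \<Rightarrow> nat \<Rightarrow> (nat \<Rightarrow> complex mat) \<Rightarrow> bool" where
  "local_operation n m K M \<longleftrightarrow>
     (\<forall>k<K. M k \<in> carrier_mat (2 ^ n) (2 ^ n * 2 ^ m)) \<and>
     mat (2 ^ n * 2 ^ m) (2 ^ n * 2 ^ m) (\<lambda>ij. \<Sum>k<K. (mat_adjoint (M k) * M k) $$ ij)
       = 1\<^sub>m (2 ^ n * 2 ^ m)"

text \<open>The unnormalised state after an execution in which Alice's Kraus operator is \<open>P\<close> and Bob's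
is \<open>Q\<close>, the probability of this event, and the resulting normalised state (meaningful only if the
probability is nonzero).\<close>

definition raw_output ::
    "nat \<Rightarrow> nat \<Rightarrow> nat \<Rightarrow> complex mat \<Rightarrow> complex mat \<Rightarrow> 'e::complex_hilbert vec \<Rightarrow> 'e vec" where
  "raw_output nA nB m P Q \<psi> = act (kron P Q) (with_epr_pairs nA nB m \<psi>)"

definition output_prob ::
    "nat \<Rightarrow> nat \<Rightarrow> nat \<Rightarrow> complex mat \<Rightarrow> complex mat \<Rightarrow> 'e::complex_hilbert vec \<Rightarrow> real" where
  "output_prob nA nB m P Q \<psi> = (state_norm (raw_output nA nB m P Q \<psi>))\<^sup>2"

definition output_state ::
    "nat \<Rightarrow> nat \<Rightarrow> nat \<Rightarrow> complex mat \<Rightarrow> complex mat \<Rightarrow> 'e::complex_hilbert vec \<Rightarrow> 'e vec" where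
  "output_state nA nB m P Q \<psi> =
     map_vec ((*\<^sub>R) (1 / state_norm (raw_output nA nB m P Q \<psi>))) (raw_output nA nB m P Q \<psi>)"

end

theory Submission
  imports Defs
begin

text \<open>
  The protocol is Vaidman's. Alice first teleports \<open>A\<close> to Bob, who then holds \<open>\<sigma>\<^sub>k \<psi>\<close> with the Pauli
  \<open>\<sigma>\<^sub>k\<close> known to Alice only. To apply a unitary \<open>R\<close> to \<open>\<psi>\<close>, Bob teleports everything to Alice, who
  receives \<open>\<sigma>\<^sub>l \<sigma>\<^sub>k \<psi>\<close>; as Paulis commute up to a phase, applying \<open>R \<sigma>\<^sub>k\<^sup>*\<close> leaves her with
  \<open>R \<sigma>\<^sub>l \<psi>\<close>, which she teleports back. With probability \<open>1/d\<^sup>2\<close> the outcome is \<open>l = 0\<close> and \<open>R\<close> has been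
  applied up to a Pauli known to Alice. Otherwise Bob, who knows \<open>l\<close>, needs \<open>R \<sigma>\<^sub>l\<^sup>* R\<^sup>*\<close> to be applied
  to the new state, and the two repeat the procedure on a separate batch of EPR pairs reserved for
  this value of \<open>l\<close>: Alice treats all batches in the same way, and Bob uses the one he needs. After \<open>r\<close>
  rounds the failure probability is \<open>(1 - 1/d\<^sup>2)\<^sup>r\<close>. Finally Bob teleports \<open>A\<close> back through a fixed batch.

  The joint Kraus operators of the whole protocol are computed by composition: whenever it succeeds,
  they are a scalar times a Pauli times \<open>U\<close>, and the squared moduli of these scalars are the probabilities.
\<close>

subsection \<open>Matrices\<close>

text \<open>Alice never learns Bob's outcome \<open>l\<close>, so a single instrument of hers,
  indexed by her key \<open>k\<close> alone, has to serve the correction for every \<open>l\<close>;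
  only Bob's instrument may depend on the target unitary. This asymmetry fixes the quantifiers of
  \<open>achieves\<close> and \<open>achievable\<close>. A local operation has one Kraus operator
  per outcome, so a batch that Bob does not need cannot be traced out; he measures his half, after
  which Alice's work on that batch amounts to a scalar.

  The scalars suffice for the analysis: a successful joint operator is a multiple of a unitary, so
  the probability of its outcome does not depend on the state. The normalisation
  \<open>1 / sqrt D\<close> of the entangled state is postponed to the end; total weights are
  therefore \<open>D\<close> instead of 1, and they multiply when batches are combined.

  The final equality is one of vectors, so phases count. Those from commuting Paulis are collected
  in the scalars and finally put on one qubit; if there is no qubit, \<open>U\<close> is itself a
  phase, which Alice's Kraus operators supply.\<close>

lemma sum_prod_index:
  fixes g :: "nat \<Rightarrow> 'a::comm_monoid_add"
  shows "(\<Sum>i<m * n. g i) = (\<Sum>i<m. \<Sum>j<n. g (i * n + j))"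
proof -
  have "(\<Sum>i<m * n. g i) = (\<Sum>i<m. sum g {i * n..<i * n + n})"
    by (simp add: sum.nat_group)
  also have "\<dots> = (\<Sum>i<m. \<Sum>j<n. g (i * n + j))"
  proof (rule sum.cong[OF refl])
    fix i
    show "sum g {i * n..<i * n + n} = (\<Sum>j<n. g (i * n + j))"
      using sum.shift_bounds_nat_ivl[of g 0 "i * n" n]
      by (simp only: lessThan_atLeast0 add.commute add_0)
  qed
  finally show ?thesis .
qed

lemma prod_index_less: "i < m \<Longrightarrow> j < n \<Longrightarrow> i * n + j < m * (n::nat)"
proof -
  assume "i < m" "j < n"
  then have "i * n + j < i * n + n" by linarith
  also have "\<dots> = Suc i * n" by (simp only: mult_Suc add.commute)
  also have "\<dots> \<le> m * n" using \<open>i < m\<close> by (intro mult_le_mono1) simp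
  finally show ?thesis .
qed

lemma div_mod_less:
  assumes "i < m * (n::nat)"
  shows "i div n < m" "i mod n < n"
  using assms by (auto simp: less_mult_imp_div_less intro!: mod_less_divisor gr0I)

lemma prod_index_div_mod [simp]:
  assumes "j < (n::nat)"
  shows "(i * n + j) div n = i" "(i * n + j) mod n = j"
  using assms by auto

lemma div_mod_eq_iff: "i div n = j div n \<and> i mod n = j mod n \<longleftrightarrow> i = (j::nat)"
proof
  assume "i div n = j div n \<and> i mod n = j mod n"
  then have "i div n * n + i mod n = j div n * n + j mod n" by presburger
  then show "i = j" by (simp only: div_mult_mod_eq)
qed simp

lemma sum_of_bool_mult_lessThan:
  fixes g :: "nat \<Rightarrow> complex"
  shows "(\<Sum>i<n. of_bool (i = j) * g i) = (if j < n then g j else 0)"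
    "(\<Sum>i<n. of_bool (j = i) * g i) = (if j < n then g j else 0)"
    "(\<Sum>i<n. g i * of_bool (i = j)) = (if j < n then g j else 0)"
    "(\<Sum>i<n. g i * of_bool (j = i)) = (if j < n then g j else 0)"
  by (auto simp: if_distrib[of "\<lambda>x. x * _"] if_distrib[of "\<lambda>x. _ * x"] of_bool_def cong: if_cong)

lemma mult_mat_index:
  assumes "A \<in> carrier_mat a b" "B \<in> carrier_mat b c" "i < a" "j < c"
  shows "(A * B) $$ (i, j) = (\<Sum>k<b. A $$ (i, k) * B $$ (k, j))"
  using assms by (auto simp: scalar_prod_def lessThan_atLeast0)

section \<open>Adjoints and unitary matrices\<close>

lemma mat_adjoint_carrier [simp]:
  fixes A :: "complex mat"
  shows "mat_adjoint A \<in> carrier_mat m n \<longleftrightarrow> A \<in> carrier_mat n m"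
  unfolding mat_adjoint_def carrier_mat_def by auto

lemma mat_adjoint_dim [simp]:
  "dim_row (mat_adjoint A) = dim_col A" "dim_col (mat_adjoint A) = dim_row A"
  by (auto simp: mat_adjoint_def)

lemma mat_adjoint_index:
  fixes A :: "complex mat"
  assumes "A \<in> carrier_mat n m" "i < m" "j < n"
  shows "mat_adjoint A $$ (i, j) = cnj (A $$ (j, i))"
  using assms by (auto simp: mat_adjoint_def mat_of_rows_index)

lemma mat_adjoint_mult:
  fixes A B :: "complex mat"
  assumes "A \<in> carrier_mat a b" "B \<in> carrier_mat b c"
  shows "mat_adjoint (A * B) = mat_adjoint B * mat_adjoint A"
proof (rule eq_matI)
  have BA: "mat_adjoint B * mat_adjoint A \<in> carrier_mat c a"
    using assms by (intro mult_carrier_mat[of _ _ b]) auto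
  have AB: "A * B \<in> carrier_mat a c" using assms by auto
  fix i j assume "i < dim_row (mat_adjoint B * mat_adjoint A)" "j < dim_col (mat_adjoint B * mat_adjoint A)"
  then have ij: "i < c" "j < a" using BA by auto
  have adj: "mat_adjoint B \<in> carrier_mat c b" "mat_adjoint A \<in> carrier_mat b a"
    using assms by auto
  show "mat_adjoint (A * B) $$ (i, j) = (mat_adjoint B * mat_adjoint A) $$ (i, j)"
    using assms ij
    by (simp add: mat_adjoint_index[OF AB] mult_mat_index[OF assms] mult_mat_index[OF adj]
        mat_adjoint_index[OF assms(1)] mat_adjoint_index[OF assms(2)] mult.commute
        del: index_mult_mat)
qed (use assms in \<open>auto simp: mat_adjoint_def\<close>)

lemma mat_adjoint_smult:
  fixes A :: "complex mat"
  shows "mat_adjoint (w \<cdot>\<^sub>m A) = cnj w \<cdot>\<^sub>m mat_adjoint A"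
proof (rule eq_matI)
  fix i j assume "i < dim_row (cnj w \<cdot>\<^sub>m mat_adjoint A)" "j < dim_col (cnj w \<cdot>\<^sub>m mat_adjoint A)"
  then have ij: "i < dim_col A" "j < dim_row A" by (auto simp: mat_adjoint_def)
  have A: "A \<in> carrier_mat (dim_row A) (dim_col A)" by simp
  then have A': "w \<cdot>\<^sub>m A \<in> carrier_mat (dim_row A) (dim_col A)" by (rule smult_carrier_mat)
  show "mat_adjoint (w \<cdot>\<^sub>m A) $$ (i, j) = (cnj w \<cdot>\<^sub>m mat_adjoint A) $$ (i, j)"
    using ij by (simp add: mat_adjoint_index[OF A ij] mat_adjoint_index[OF A' ij])
qed (auto simp: mat_adjoint_def)

lemma mat_adjoint_adjoint [simp]:
  fixes A :: "complex mat"
  shows "mat_adjoint (mat_adjoint A) = A"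
proof (rule eq_matI)
  have A: "A \<in> carrier_mat (dim_row A) (dim_col A)" by simp
  then have A': "mat_adjoint A \<in> carrier_mat (dim_col A) (dim_row A)" by (subst mat_adjoint_carrier)
  fix i j assume "i < dim_row A" "j < dim_col A"
  then show "mat_adjoint (mat_adjoint A) $$ (i, j) = A $$ (i, j)"
    by (simp add: mat_adjoint_index[OF A'] mat_adjoint_index[OF A])
qed (auto simp: mat_adjoint_def)

lemma mat_adjoint_one [simp]: "mat_adjoint (1\<^sub>m n :: complex mat) = 1\<^sub>m n"
proof (rule eq_matI)
  fix i j assume "i < dim_row (1\<^sub>m n :: complex mat)" "j < dim_col (1\<^sub>m n :: complex mat)"
  then show "mat_adjoint (1\<^sub>m n :: complex mat) $$ (i, j) = 1\<^sub>m n $$ (i, j)"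
    by (subst mat_adjoint_index[of _ n n]) auto
qed (auto simp: mat_adjoint_def)

lemma unitary_mat_carrier: "unitary_mat d U \<Longrightarrow> U \<in> carrier_mat d d"
  by (simp add: unitary_mat_def)

lemma unitary_mat_one: "unitary_mat d (1\<^sub>m d)"
  by (simp add: unitary_mat_def)

lemma unitary_mat_adjoint: "unitary_mat d U \<Longrightarrow> unitary_mat d (mat_adjoint U)"
  by (simp add: unitary_mat_def)

lemma smult_smult_mat_assoc: "a \<cdot>\<^sub>m (b \<cdot>\<^sub>m A) = (a * b) \<cdot>\<^sub>m (A :: complex mat)"
  by (rule eq_matI) auto

lemma one_smult_mat: "1 \<cdot>\<^sub>m A = (A :: complex mat)"
  by (rule eq_matI) auto

lemma unitary_mat_smult:
  assumes "unitary_mat d U" "norm w = 1"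
  shows "unitary_mat d (w \<cdot>\<^sub>m U)"
proof -
  have w: "w * cnj w = 1"
    using assms(2) by (simp add: complex_norm_square[symmetric])
  show ?thesis
    using assms(1) w
    by (simp add: unitary_mat_def mat_adjoint_smult mult_smult_distrib[of _ d d _ d]
        mult_smult_assoc_mat[of _ d d _ d] smult_smult_mat_assoc mult.commute one_smult_mat)
qed

lemma unitary_mat_mult:
  assumes "unitary_mat d U" "unitary_mat d V"
  shows "unitary_mat d (U * V)"
proof -
  note c = unitary_mat_carrier[OF assms(1)] unitary_mat_carrier[OF assms(2)]
  have c': "mat_adjoint U \<in> carrier_mat d d" "mat_adjoint V \<in> carrier_mat d d"
    using c by simp_all
  have "mat_adjoint V * mat_adjoint U * (U * V) = mat_adjoint V * (mat_adjoint U * U) * V"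
    using c c' by (simp add: assoc_mult_mat[of _ d d _ d _ d] mult_carrier_mat[of _ d d _ d])
  moreover have "U * V * (mat_adjoint V * mat_adjoint U) = U * (V * mat_adjoint V) * mat_adjoint U"
    using c c' by (simp add: assoc_mult_mat[of _ d d _ d _ d] mult_carrier_mat[of _ d d _ d])
  ultimately show ?thesis
    using assms c c' by (simp add: unitary_mat_def mat_adjoint_mult[of _ d d _ d])
qed

lemma unitary_mat_cancel:
  assumes "unitary_mat d A" "B \<in> carrier_mat d c"
  shows "mat_adjoint A * (A * B) = B"
proof -
  have A: "A \<in> carrier_mat d d" "mat_adjoint A \<in> carrier_mat d d"
    using assms(1) by (simp_all add: unitary_mat_def)
  have "mat_adjoint A * (A * B) = mat_adjoint A * A * B"
    by (rule assoc_mult_mat[symmetric, OF A(2) A(1) assms(2)])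
  also have "\<dots> = B"
    using assms by (simp add: unitary_mat_def)
  finally show ?thesis .
qed

section \<open>Kronecker products\<close>

lemma kron_carrier [intro]:
  "P \<in> carrier_mat a b \<Longrightarrow> Q \<in> carrier_mat c d \<Longrightarrow> kron P Q \<in> carrier_mat (a * c) (b * d)"
  by (auto simp: kron_def)

lemma kron_index:
  assumes "P \<in> carrier_mat a b" "Q \<in> carrier_mat c d" "i < a * c" "j < b * d"
  shows "kron P Q $$ (i, j) = P $$ (i div c, j div d) * Q $$ (i mod c, j mod d)"
  using assms by (auto simp: kron_def)

lemma kron_mult:
  assumes A: "A \<in> carrier_mat a b" and B: "B \<in> carrier_mat b c"
    and P: "P \<in> carrier_mat a' b'" and Q: "Q \<in> carrier_mat b' c'"
  shows "kron A P * kron B Q = kron (A * B) (P * Q)"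
proof (rule eq_matI)
  have AB: "A * B \<in> carrier_mat a c" and PQ: "P * Q \<in> carrier_mat a' c'" using assms by auto
  note k = kron_carrier[OF A P] kron_carrier[OF B Q]
  fix i j assume "i < dim_row (kron (A * B) (P * Q))" "j < dim_col (kron (A * B) (P * Q))"
  then have ij: "i < a * a'" "j < c * c'" using kron_carrier[OF AB PQ] by auto
  note ij' = div_mod_less[OF ij(1)] div_mod_less[OF ij(2)]
  have "(kron A P * kron B Q) $$ (i, j) = (\<Sum>u<b * b'. kron A P $$ (i, u) * kron B Q $$ (u, j))"
    by (rule mult_mat_index[OF k ij])
  also have "\<dots> = (\<Sum>u<b. \<Sum>v<b'. A $$ (i div a', u) * P $$ (i mod a', v) * (B $$ (u, j div c') * Q $$ (v, j mod c')))"
    unfolding sum_prod_index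
    by (intro sum.cong refl) (simp add: kron_index[OF A P] kron_index[OF B Q] ij prod_index_less)
  also have "\<dots> = (A * B) $$ (i div a', j div c') * (P * Q) $$ (i mod a', j mod c')"
    using ij' by (simp add: mult_mat_index[OF A B] mult_mat_index[OF P Q] sum_product mult_ac)
  also have "\<dots> = kron (A * B) (P * Q) $$ (i, j)"
    by (simp add: kron_index[OF AB PQ ij])
  finally show "(kron A P * kron B Q) $$ (i, j) = kron (A * B) (P * Q) $$ (i, j)" .
qed (use assms in \<open>auto simp: kron_def\<close>)

lemma kron_one: "kron (1\<^sub>m m) (1\<^sub>m n) = 1\<^sub>m (m * n)"
proof (rule eq_matI)
  fix i j assume "i < dim_row (1\<^sub>m (m * n) :: complex mat)" "j < dim_col (1\<^sub>m (m * n) :: complex mat)"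
  then have ij: "i < m * n" "j < m * n" by auto
  show "kron (1\<^sub>m m) (1\<^sub>m n) $$ (i, j) = (1\<^sub>m (m * n) :: complex mat) $$ (i, j)"
    using ij div_mod_less[OF ij(1)] div_mod_less[OF ij(2)] div_mod_eq_iff[of i n j]
    by (auto simp: kron_index[of _ m m _ n n])
qed (auto simp: kron_def)

lemma kron_adjoint: "mat_adjoint (kron P Q) = kron (mat_adjoint P) (mat_adjoint Q)"
proof (rule eq_matI)
  let ?a = "dim_row P" and ?b = "dim_col P" and ?c = "dim_row Q" and ?d = "dim_col Q"
  have P: "P \<in> carrier_mat ?a ?b" and Q: "Q \<in> carrier_mat ?c ?d" by auto
  have P': "mat_adjoint P \<in> carrier_mat ?b ?a" and Q': "mat_adjoint Q \<in> carrier_mat ?d ?c"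
    by (auto simp: mat_adjoint_def)
  fix i j assume "i < dim_row (kron (mat_adjoint P) (mat_adjoint Q))" "j < dim_col (kron (mat_adjoint P) (mat_adjoint Q))"
  then have ij: "i < ?b * ?d" "j < ?a * ?c" using kron_carrier[OF P' Q'] by auto
  then show "mat_adjoint (kron P Q) $$ (i, j) = kron (mat_adjoint P) (mat_adjoint Q) $$ (i, j)"
    using div_mod_less[OF ij(1)] div_mod_less[OF ij(2)]
    by (simp add: mat_adjoint_index[OF kron_carrier[OF P Q]] kron_index[OF P Q] kron_index[OF P' Q']
        mat_adjoint_index[OF P] mat_adjoint_index[OF Q])
qed (auto simp: kron_def mat_adjoint_def)

lemma kron_smult_left: "kron (w \<cdot>\<^sub>m P) Q = w \<cdot>\<^sub>m kron P Q"
  by (rule eq_matI) (auto simp: kron_def div_mod_less)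

lemma kron_smult_right: "kron P (w \<cdot>\<^sub>m Q) = w \<cdot>\<^sub>m kron P Q"
  by (rule eq_matI) (auto simp: kron_def div_mod_less)

lemma unitary_mat_kron:
  assumes "unitary_mat a P" "unitary_mat b Q"
  shows "unitary_mat (a * b) (kron P Q)"
  using assms
  by (auto simp: unitary_mat_def kron_adjoint kron_mult[of _ a a _ a _ b b _ b] kron_one)

section \<open>Qubit-wise unitaries\<close>

lemma qubitwise_unitary_0: "qubitwise_unitary 0 V \<longleftrightarrow> V = 1\<^sub>m 1"
  by (auto simp: qubitwise_unitary_def)

text \<open>Splitting off the first qubit replaces the list of factors by a recursion, along which
  the closure properties below are proved.\<close>

lemma qubitwise_unitary_Suc:
  "qubitwise_unitary (Suc n) V \<longleftrightarrow> (\<exists>v W. unitary_mat 2 v \<and> qubitwise_unitary n W \<and> V = kron v W)"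
proof
  assume "qubitwise_unitary (Suc n) V"
  then obtain v vs where "length vs = n" "\<forall>v\<in>set (v # vs). unitary_mat 2 v" "V = foldr kron (v # vs) (1\<^sub>m 1)"
    unfolding qubitwise_unitary_def by (metis length_Suc_conv)
  then show "\<exists>v W. unitary_mat 2 v \<and> qubitwise_unitary n W \<and> V = kron v W"
    by (auto simp: qubitwise_unitary_def)
next
  assume "\<exists>v W. unitary_mat 2 v \<and> qubitwise_unitary n W \<and> V = kron v W"
  then obtain v vs where "unitary_mat 2 v" "length vs = n" "\<forall>v\<in>set vs. unitary_mat 2 v"
    "V = kron v (foldr kron vs (1\<^sub>m 1))"
    by (auto simp: qubitwise_unitary_def)
  then show "qubitwise_unitary (Suc n) V"
    unfolding qubitwise_unitary_def by (intro exI[of _ "v # vs"]) auto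
qed

lemma qubitwise_unitary_unitary: "qubitwise_unitary n V \<Longrightarrow> unitary_mat (2 ^ n) V"
proof (induction n arbitrary: V)
  case (Suc n)
  then obtain v W where "unitary_mat 2 v" "qubitwise_unitary n W" "V = kron v W"
    unfolding qubitwise_unitary_Suc by blast
  then show ?case using Suc.IH unitary_mat_kron[of 2 v "2 ^ n" W] by simp
qed (simp add: qubitwise_unitary_0 unitary_mat_one)

lemma qubitwise_unitary_one: "qubitwise_unitary n (1\<^sub>m (2 ^ n))"
proof (induction n)
  case (Suc n)
  then show ?case
    unfolding qubitwise_unitary_Suc
    by (intro exI[of _ "1\<^sub>m 2"] exI[of _ "1\<^sub>m (2 ^ n)"]) (simp add: unitary_mat_one kron_one)
qed (simp add: qubitwise_unitary_0)

lemma qubitwise_unitary_adjoint: "qubitwise_unitary n V \<Longrightarrow> qubitwise_unitary n (mat_adjoint V)"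
proof (induction n arbitrary: V)
  case (Suc n)
  then obtain v W where "unitary_mat 2 v" "qubitwise_unitary n W" "V = kron v W"
    unfolding qubitwise_unitary_Suc by blast
  then show ?case
    unfolding qubitwise_unitary_Suc using Suc.IH[of W] unitary_mat_adjoint[of 2 v] kron_adjoint[of v W] by blast
qed (simp add: qubitwise_unitary_0)

lemma qubitwise_unitary_mult:
  "qubitwise_unitary n V \<Longrightarrow> qubitwise_unitary n W \<Longrightarrow> qubitwise_unitary n (V * W)"
proof (induction n arbitrary: V W)
  case (Suc n)
  obtain v V' where v: "unitary_mat 2 v" "qubitwise_unitary n V'" "V = kron v V'"
    using Suc.prems(1) unfolding qubitwise_unitary_Suc by blast
  obtain w W' where w: "unitary_mat 2 w" "qubitwise_unitary n W'" "W = kron w W'"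
    using Suc.prems(2) unfolding qubitwise_unitary_Suc by blast
  note c = v(1)[THEN unitary_mat_carrier] w(1)[THEN unitary_mat_carrier]
    v(2)[THEN qubitwise_unitary_unitary, THEN unitary_mat_carrier]
    w(2)[THEN qubitwise_unitary_unitary, THEN unitary_mat_carrier]
  have "V * W = kron (v * w) (V' * W')"
    unfolding v(3) w(3) by (rule kron_mult[OF c])
  then show ?case
    unfolding qubitwise_unitary_Suc
    using unitary_mat_mult[OF v(1) w(1)] Suc.IH[OF v(2) w(2)] by blast
qed (simp add: qubitwise_unitary_0)

text \<open>One tensor factor takes the phase. For \<open>n = 0\<close> the only qubit-wise unitary
  is \<open>1\<^sub>m 1\<close>, which has no factor to take it.\<close>

lemma qubitwise_unitary_smult:
  assumes "qubitwise_unitary n V" "norm w = 1" "n > 0"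
  shows "qubitwise_unitary n (w \<cdot>\<^sub>m V)"
proof -
  obtain n' where [simp]: "n = Suc n'" using \<open>n > 0\<close> gr0_implies_Suc by blast
  show ?thesis using assms
    by (auto simp: qubitwise_unitary_Suc kron_smult_left[symmetric]) (blast intro: unitary_mat_smult)
qed

subsection \<open>Local instruments and their composition\<close>

text \<open>A Kraus operator \<open>P\<close> acts on a register and on one half of a maximally entangled state of local
dimension \<open>D\<close>; \<open>P x u s\<close> is its entry for the basis state \<open>x\<close> of that half, the output \<open>u\<close> and the
input \<open>s\<close> of the register. The registers before and after have dimensions \<open>a\<close> and \<open>a'\<close>.\<close>

definition instrument :: "nat \<Rightarrow> nat \<Rightarrow> nat \<Rightarrow> nat \<Rightarrow> (nat \<Rightarrow> nat \<Rightarrow> nat \<Rightarrow> nat \<Rightarrow> complex) \<Rightarrow> bool" where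
  "instrument a a' D K P \<longleftrightarrow> (\<forall>x<D. \<forall>y<D. \<forall>s<a. \<forall>t<a.
     (\<Sum>k<K. \<Sum>u<a'. cnj (P k x u s) * P k y u t) = of_bool (x = y \<and> s = t))"

text \<open>\<open>P1\<close> followed by \<open>P2\<close>, each with its own share of the entanglement: the basis state \<open>x\<close> of the
combined half stands for the pair \<open>(x div D2, x mod D2)\<close>.\<close>

definition seq_op :: "nat \<Rightarrow> nat \<Rightarrow> (nat \<Rightarrow> nat \<Rightarrow> nat \<Rightarrow> complex) \<Rightarrow> (nat \<Rightarrow> nat \<Rightarrow> nat \<Rightarrow> complex) \<Rightarrow>
    nat \<Rightarrow> nat \<Rightarrow> nat \<Rightarrow> complex" where
  "seq_op D2 a' P2 P1 = (\<lambda>x u s. \<Sum>v<a'. P2 (x mod D2) u v * P1 (x div D2) v s)"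

text \<open>The action of Alice's \<open>P\<close> and Bob's \<open>Q\<close> on the two registers, up to the normalisation \<open>1 / sqrt D\<close>
of the entangled state.\<close>

definition joint_op :: "nat \<Rightarrow> nat \<Rightarrow> nat \<Rightarrow> nat \<Rightarrow> nat \<Rightarrow> (nat \<Rightarrow> nat \<Rightarrow> nat \<Rightarrow> complex) \<Rightarrow>
    (nat \<Rightarrow> nat \<Rightarrow> nat \<Rightarrow> complex) \<Rightarrow> complex mat" where
  "joint_op a a' b b' D P Q = mat (a' * b') (a * b)
     (\<lambda>(u, s). \<Sum>x<D. P x (u div b') (s div b) * Q x (u mod b') (s mod b))"

lemma joint_op_carrier [simp]: "joint_op a a' b b' D P Q \<in> carrier_mat (a' * b') (a * b)"
  by (simp add: joint_op_def)

lemma joint_op_dim [simp]: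
  "dim_row (joint_op a a' b b' D P Q) = a' * b'" "dim_col (joint_op a a' b b' D P Q) = a * b"
  by (simp_all add: joint_op_def)

lemma joint_op_index:
  "u < a' * b' \<Longrightarrow> s < a * b \<Longrightarrow> joint_op a a' b b' D P Q $$ (u, s) =
    (\<Sum>x<D. P x (u div b') (s div b) * Q x (u mod b') (s mod b))"
  by (simp add: joint_op_def)

lemma instrumentD:
  assumes "instrument a a' D K P" "x < D" "y < D" "s < a" "t < a"
  shows "(\<Sum>k<K. \<Sum>u<a'. cnj (P k x u s) * P k y u t) = of_bool (x = y \<and> s = t)"
  using assms by (simp add: instrument_def)

lemma sum_swap4:
  "(\<Sum>v\<in>A. \<Sum>w\<in>B. \<Sum>x\<in>C. \<Sum>y\<in>D. f v w x y) = (\<Sum>y\<in>D. \<Sum>x\<in>C. \<Sum>v\<in>A. \<Sum>w\<in>B. f v w x y)"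
proof -
  have "(\<Sum>v\<in>A. \<Sum>w\<in>B. \<Sum>x\<in>C. \<Sum>y\<in>D. f v w x y) = (\<Sum>v\<in>A. \<Sum>w\<in>B. \<Sum>y\<in>D. \<Sum>x\<in>C. f v w x y)"
    by (rule sum.cong[OF refl], rule sum.cong[OF refl], rule sum.swap)
  also have "\<dots> = (\<Sum>v\<in>A. \<Sum>y\<in>D. \<Sum>w\<in>B. \<Sum>x\<in>C. f v w x y)"
    by (rule sum.cong[OF refl], rule sum.swap)
  also have "\<dots> = (\<Sum>y\<in>D. \<Sum>v\<in>A. \<Sum>w\<in>B. \<Sum>x\<in>C. f v w x y)"
    by (rule sum.swap)
  also have "\<dots> = (\<Sum>y\<in>D. \<Sum>v\<in>A. \<Sum>x\<in>C. \<Sum>w\<in>B. f v w x y)"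
    by (rule sum.cong[OF refl], rule sum.cong[OF refl], rule sum.swap)
  also have "\<dots> = (\<Sum>y\<in>D. \<Sum>x\<in>C. \<Sum>v\<in>A. \<Sum>w\<in>B. f v w x y)"
    by (rule sum.cong[OF refl], rule sum.swap)
  finally show ?thesis .
qed

text \<open>The combined halves agree exactly if both components do, so the sum over
  \<open>D1 * D2\<close> splits, and for fixed components the sums over Alice's and Bob's
  intermediate registers separate. Hence a protocol without communication can be analysed in stages,
  by multiplying the joint matrices.\<close>

lemma joint_op_seq:
  "joint_op a a'' b b'' (D1 * D2) (seq_op D2 a' P2 P1) (seq_op D2 b' Q2 Q1) =
    joint_op a' a'' b' b'' D2 P2 Q2 * joint_op a a' b b' D1 P1 Q1"
proof (rule eq_matI)
  let ?J1 = "joint_op a a' b b' D1 P1 Q1" and ?J2 = "joint_op a' a'' b' b'' D2 P2 Q2"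
  fix u s assume "u < dim_row (?J2 * ?J1)" "s < dim_col (?J2 * ?J1)"
  then have us: "u < a'' * b''" "s < a * b" by (auto simp: joint_op_def)
  have "(?J2 * ?J1) $$ (u, s) = (\<Sum>v<a' * b'. ?J2 $$ (u, v) * ?J1 $$ (v, s))"
    by (rule mult_mat_index[OF joint_op_carrier joint_op_carrier us])
  also have "\<dots> = (\<Sum>v<a'. \<Sum>w<b'. (\<Sum>x<D2. P2 x (u div b'') v * Q2 x (u mod b'') w) *
      (\<Sum>y<D1. P1 y v (s div b) * Q1 y w (s mod b)))"
    unfolding sum_prod_index
    by (intro sum.cong refl) (simp add: joint_op_index us prod_index_less)
  also have "\<dots> = (\<Sum>y<D1. \<Sum>x<D2. \<Sum>v<a'. \<Sum>w<b'. P2 x (u div b'') v * Q2 x (u mod b'') w *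
      (P1 y v (s div b) * Q1 y w (s mod b)))"
    unfolding sum_product by (rule sum_swap4)
  also have "\<dots> = (\<Sum>y<D1. \<Sum>x<D2. (\<Sum>v<a'. P2 x (u div b'') v * P1 y v (s div b)) *
      (\<Sum>w<b'. Q2 x (u mod b'') w * Q1 y w (s mod b)))"
    unfolding sum_product by (intro sum.cong refl) (simp add: mult_ac)
  also have "\<dots> = joint_op a a'' b b'' (D1 * D2) (seq_op D2 a' P2 P1) (seq_op D2 b' Q2 Q1) $$ (u, s)"
    unfolding joint_op_index[OF us] sum_prod_index
    by (intro sum.cong refl) (simp add: seq_op_def)
  finally show "joint_op a a'' b b'' (D1 * D2) (seq_op D2 a' P2 P1) (seq_op D2 b' Q2 Q1) $$ (u, s) =
    (?J2 * ?J1) $$ (u, s)" by simp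
qed (auto simp: joint_op_def)

text \<open>\<open>P2\<close> may be chosen by the outcome \<open>i\<close> of \<open>P1\<close>:
  its completeness relation is used for each fixed \<open>i\<close>, before the sum over
  \<open>i\<close>. As the pair of outcomes is coded by one number, all the \<open>P2 i\<close> need
  the same number \<open>K2\<close> of outcomes.\<close>

lemma instrument_seq:
  assumes P1: "instrument a a' D1 K1 P1" and P2: "\<And>i. i < K1 \<Longrightarrow> instrument a' a'' D2 K2 (P2 i)"
  shows "instrument a a'' (D1 * D2) (K1 * K2)
    (\<lambda>k. seq_op D2 a' (P2 (k div K2) (k mod K2)) (P1 (k div K2)))"
  unfolding instrument_def
proof (intro allI impI)
  fix x y s t assume xy: "x < D1 * D2" "y < D1 * D2" and st: "s < a" "t < a"
  note x = div_mod_less[OF xy(1)] and y = div_mod_less[OF xy(2)]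
  let ?x1 = "x div D2" and ?x2 = "x mod D2" and ?y1 = "y div D2" and ?y2 = "y mod D2"
  have "(\<Sum>k<K1 * K2. \<Sum>u<a''. cnj (seq_op D2 a' (P2 (k div K2) (k mod K2)) (P1 (k div K2)) x u s) *
        seq_op D2 a' (P2 (k div K2) (k mod K2)) (P1 (k div K2)) y u t) =
      (\<Sum>i<K1. \<Sum>j<K2. \<Sum>u<a''. cnj (seq_op D2 a' (P2 i j) (P1 i) x u s) * seq_op D2 a' (P2 i j) (P1 i) y u t)"
    unfolding sum_prod_index by (intro sum.cong refl) simp
  also have "\<dots> = (\<Sum>i<K1. \<Sum>j<K2. \<Sum>u<a''. \<Sum>v<a'. \<Sum>w<a'. cnj (P2 i j ?x2 u v * P1 i ?x1 v s) *
      (P2 i j ?y2 u w * P1 i ?y1 w t))"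
    by (simp only: seq_op_def cnj_sum sum_product)
  also have "\<dots> = (\<Sum>i<K1. \<Sum>w<a'. \<Sum>v<a'. \<Sum>j<K2. \<Sum>u<a''. cnj (P2 i j ?x2 u v * P1 i ?x1 v s) *
      (P2 i j ?y2 u w * P1 i ?y1 w t))"
    by (rule sum.cong[OF refl], rule sum_swap4)
  also have "\<dots> = (\<Sum>i<K1. \<Sum>w<a'. \<Sum>v<a'. cnj (P1 i ?x1 v s) * P1 i ?y1 w t *
      (\<Sum>j<K2. \<Sum>u<a''. cnj (P2 i j ?x2 u v) * P2 i j ?y2 u w))"
    by (simp add: sum_distrib_left mult_ac)
  also have "\<dots> = (\<Sum>i<K1. \<Sum>w<a'. \<Sum>v<a'. cnj (P1 i ?x1 v s) * P1 i ?y1 w t * of_bool (?x2 = ?y2 \<and> v = w))"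
    by (intro sum.cong refl) (simp add: instrumentD[OF P2] x y)
  also have "\<dots> = (\<Sum>i<K1. \<Sum>w<a'. of_bool (?x2 = ?y2) * (cnj (P1 i ?x1 w s) * P1 i ?y1 w t))"
    by (intro sum.cong refl) (cases "?x2 = ?y2"; simp add: sum_of_bool_mult_lessThan)
  also have "\<dots> = of_bool (?x2 = ?y2) * (\<Sum>i<K1. \<Sum>w<a'. cnj (P1 i ?x1 w s) * P1 i ?y1 w t)"
    by (simp add: sum_distrib_left)
  also have "\<dots> = of_bool (?x2 = ?y2) * of_bool (?x1 = ?y1 \<and> s = t)"
    by (simp add: instrumentD[OF P1 x(1) y(1) st])
  also have "\<dots> = of_bool (x = y \<and> s = t)"
    using div_mod_eq_iff[of x D2 y] by (auto simp: of_bool_def)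
  finally show "(\<Sum>k<K1 * K2. \<Sum>u<a''. cnj (seq_op D2 a' (P2 (k div K2) (k mod K2)) (P1 (k div K2)) x u s) *
        seq_op D2 a' (P2 (k div K2) (k mod K2)) (P1 (k div K2)) y u t) = of_bool (x = y \<and> s = t)" .
qed

text \<open>Zero operators stand for outcomes that never occur; they equalise the numbers of
  outcomes as \<open>instrument_seq\<close> requires.\<close>

lemma instrument_pad:
  assumes "instrument a a' D K P" "K \<le> K'"
  shows "instrument a a' D K' (\<lambda>k. if k < K then P k else (\<lambda>x u s. 0))"
proof -
  have "(\<Sum>k<K'. \<Sum>u<a'. cnj ((if k < K then P k else (\<lambda>x u s. 0)) x u s) * (if k < K then P k else (\<lambda>x u s. 0)) y u t)
    = (\<Sum>k<K. \<Sum>u<a'. cnj (P k x u s) * P k y u t)" for x y s t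
    using assms(2) by (intro sum.mono_neutral_cong_right) auto
  with assms(1) show ?thesis unfolding instrument_def by presburger
qed

text \<open>A measurement of the half in the standard basis that leaves the register alone: the way
  to dispose of a batch with one Kraus operator per outcome.\<close>

definition measure_op :: "nat \<Rightarrow> nat \<Rightarrow> nat \<Rightarrow> nat \<Rightarrow> complex" where
  "measure_op k x u s = of_bool (x = k \<and> u = s)"

lemma instrument_measure: "instrument a a D D measure_op"
  unfolding instrument_def
proof (intro allI impI)
  fix x y s t assume *: "x < D" "y < D" "s < a" "t < a"
  have "(\<Sum>k<D. \<Sum>u<a. cnj (measure_op k x u s) * measure_op k y u t) =
      (\<Sum>k<D. of_bool (x = k) * (of_bool (y = k) * (\<Sum>u<a. of_bool (s = u) * of_bool (t = u))))"
    by (auto simp: measure_op_def sum_distrib_left of_bool_def intro!: sum.cong)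
  also have "\<dots> = of_bool (x = y \<and> s = t)"
    using * by (simp add: sum_of_bool_mult_lessThan) (auto simp: of_bool_def)
  finally show "(\<Sum>k<D. \<Sum>u<a. cnj (measure_op k x u s) * measure_op k y u t) = of_bool (x = y \<and> s = t)" .
qed

text \<open>Bob's result \<open>y\<close> leaves Alice's half in the basis state \<open>y\<close>,
  so her operator on this batch shrinks to a scalar.\<close>

lemma joint_op_measure:
  assumes "y < D"
  shows "joint_op 1 1 d d D P (measure_op y) = P y 0 0 \<cdot>\<^sub>m 1\<^sub>m d"
proof (rule eq_matI)
  fix i j assume "i < dim_row (P y 0 0 \<cdot>\<^sub>m 1\<^sub>m d)" "j < dim_col (P y 0 0 \<cdot>\<^sub>m 1\<^sub>m d)"
  then have ij: "i < d" "j < d" by auto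
  have "joint_op 1 1 d d D P (measure_op y) $$ (i, j) = (\<Sum>x<D. of_bool (x = y) * (P x 0 0 * of_bool (i = j)))"
    using ij by (auto simp: joint_op_index measure_op_def of_bool_def intro!: sum.cong)
  also have "\<dots> = P y 0 0 * of_bool (i = j)"
    using assms by (simp add: sum_of_bool_mult_lessThan)
  finally show "joint_op 1 1 d d D P (measure_op y) $$ (i, j) = (P y 0 0 \<cdot>\<^sub>m 1\<^sub>m d) $$ (i, j)"
    using ij by simp
qed (auto simp: joint_op_def)

text \<open>For each result \<open>y\<close> on a discarded batch, Alice's scalars have total weight
  1, so discarding costs no success probability.\<close>

lemma instrument_sum_norm:
  assumes "instrument 1 1 D K P" "y < D"
  shows "(\<Sum>k<K. (norm (P k y 0 0))\<^sup>2) = 1"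
proof -
  have "complex_of_real (\<Sum>k<K. (norm (P k y 0 0))\<^sup>2) = (\<Sum>k<K. \<Sum>u<1. cnj (P k y u 0) * P k y u 0)"
    by (simp add: complex_norm_square mult.commute del: of_real_power)
  also have "\<dots> = 1" using instrumentD[OF assms(1) assms(2) assms(2), of 0 0] by simp
  finally show ?thesis by (simp only: of_real_eq_1_iff)
qed

subsection \<open>Pauli operators\<close>

text \<open>What the protocol needs of the Paulis, in any dimension: \<open>complete\<close> makes
  the Bell measurement exhaustive, \<open>commute\<close> lets Alice remove her key behind Bob's
  byproduct at the price of a phase, and index 0 is the outcome without byproduct.\<close>

locale error_basis =
  fixes d :: nat and \<sigma> :: "nat \<Rightarrow> complex mat"
  assumes unitary: "k < d * d \<Longrightarrow> unitary_mat d (\<sigma> k)"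
    and zero: "\<sigma> 0 = 1\<^sub>m d"
    and commute: "k < d * d \<Longrightarrow> l < d * d \<Longrightarrow> \<exists>w. norm w = 1 \<and> \<sigma> l * \<sigma> k = w \<cdot>\<^sub>m (\<sigma> k * \<sigma> l)"
    and complete: "i < d \<Longrightarrow> j < d \<Longrightarrow> i' < d \<Longrightarrow> j' < d \<Longrightarrow>
      (\<Sum>k<d * d. cnj (\<sigma> k $$ (i, j)) * \<sigma> k $$ (i', j')) = of_nat d * of_bool (i = i' \<and> j = j')"
begin

lemma carrier: "k < d * d \<Longrightarrow> \<sigma> k \<in> carrier_mat d d"
  using unitary unitary_mat_carrier by blast

lemma dim_pos: "k < d * d \<Longrightarrow> d > 0"
  by (cases d) auto

end

lemma error_basis_one: "error_basis 1 (\<lambda>k. 1\<^sub>m 1)"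
proof
  show "\<exists>w. norm w = 1 \<and> 1\<^sub>m 1 * 1\<^sub>m 1 = w \<cdot>\<^sub>m (1\<^sub>m 1 * 1\<^sub>m 1 :: complex mat)"
    by (intro exI[of _ 1]) (simp add: one_smult_mat)
qed (auto simp: unitary_mat_one)

text \<open>Commutation phases multiply, and the completeness sum factors once its index is split.
  This builds the basis of a register qubit by qubit and later joins those of \<open>A\<close> and
  \<open>B\<close>.\<close>

lemma error_basis_kron:
  assumes \<sigma>: "error_basis a \<sigma>" and \<tau>: "error_basis b \<tau>"
  shows "error_basis (a * b) (\<lambda>k. kron (\<sigma> (k div (b * b))) (\<tau> (k mod (b * b))))"
proof
  interpret s: error_basis a \<sigma> by fact
  interpret t: error_basis b \<tau> by fact
  have split: "k div (b * b) < a * a" "k mod (b * b) < b * b" if "k < a * b * (a * b)" for k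
    using div_mod_less[of k "a * a" "b * b"] that by (simp_all add: mult_ac)
  show "unitary_mat (a * b) (kron (\<sigma> (k div (b * b))) (\<tau> (k mod (b * b))))" if "k < a * b * (a * b)" for k
    using split[OF that] by (intro unitary_mat_kron s.unitary t.unitary)
  show "kron (\<sigma> (0 div (b * b))) (\<tau> (0 mod (b * b))) = 1\<^sub>m (a * b)"
    by (simp add: s.zero t.zero kron_one)
  show "\<exists>w. norm w = 1 \<and> kron (\<sigma> (l div (b * b))) (\<tau> (l mod (b * b))) * kron (\<sigma> (k div (b * b))) (\<tau> (k mod (b * b))) =
      w \<cdot>\<^sub>m (kron (\<sigma> (k div (b * b))) (\<tau> (k mod (b * b))) * kron (\<sigma> (l div (b * b))) (\<tau> (l mod (b * b))))"
    if kl: "k < a * b * (a * b)" "l < a * b * (a * b)" for k l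
  proof -
    note k = split[OF kl(1)] and l = split[OF kl(2)]
    obtain w where w: "norm w = 1" "\<sigma> (l div (b * b)) * \<sigma> (k div (b * b)) = w \<cdot>\<^sub>m (\<sigma> (k div (b * b)) * \<sigma> (l div (b * b)))"
      using s.commute[OF k(1) l(1)] by blast
    obtain w' where w': "norm w' = 1" "\<tau> (l mod (b * b)) * \<tau> (k mod (b * b)) = w' \<cdot>\<^sub>m (\<tau> (k mod (b * b)) * \<tau> (l mod (b * b)))"
      using t.commute[OF k(2) l(2)] by blast
    show ?thesis
      using w w'
      by (intro exI[of _ "w * w'"])
        (simp add: kron_mult[OF s.carrier[OF k(1)] s.carrier[OF l(1)] t.carrier[OF k(2)] t.carrier[OF l(2)]]
          kron_mult[OF s.carrier[OF l(1)] s.carrier[OF k(1)] t.carrier[OF l(2)] t.carrier[OF k(2)]]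
          norm_mult kron_smult_left kron_smult_right smult_smult_mat_assoc mult.commute)
  qed
  show "(\<Sum>k<a * b * (a * b). cnj (kron (\<sigma> (k div (b * b))) (\<tau> (k mod (b * b))) $$ (i, j)) *
      kron (\<sigma> (k div (b * b))) (\<tau> (k mod (b * b))) $$ (i', j')) = of_nat (a * b) * of_bool (i = i' \<and> j = j')"
    if ij: "i < a * b" "j < a * b" "i' < a * b" "j' < a * b" for i j i' j'
  proof -
    note i = div_mod_less[OF ij(1)] and j = div_mod_less[OF ij(2)]
      and i' = div_mod_less[OF ij(3)] and j' = div_mod_less[OF ij(4)]
    have "(\<Sum>k<a * b * (a * b). cnj (kron (\<sigma> (k div (b * b))) (\<tau> (k mod (b * b))) $$ (i, j)) *
        kron (\<sigma> (k div (b * b))) (\<tau> (k mod (b * b))) $$ (i', j')) =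
      (\<Sum>k<(a * a) * (b * b). cnj (kron (\<sigma> (k div (b * b))) (\<tau> (k mod (b * b))) $$ (i, j)) *
        kron (\<sigma> (k div (b * b))) (\<tau> (k mod (b * b))) $$ (i', j'))"
      by (simp add: mult_ac)
    also have "\<dots> = (\<Sum>k<a * a. \<Sum>l<b * b. (cnj (\<sigma> k $$ (i div b, j div b)) * \<sigma> k $$ (i' div b, j' div b)) *
        (cnj (\<tau> l $$ (i mod b, j mod b)) * \<tau> l $$ (i' mod b, j' mod b)))"
      unfolding sum_prod_index[of _ "a * a" "b * b"]
      by (intro sum.cong refl)
        (simp add: kron_index[OF s.carrier t.carrier] ij mult_ac)
    also have "\<dots> = (of_nat a * of_bool (i div b = i' div b \<and> j div b = j' div b)) *
        (of_nat b * of_bool (i mod b = i' mod b \<and> j mod b = j' mod b))"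
      by (simp only: sum_product[symmetric] s.complete[OF i(1) j(1) i'(1) j'(1)] t.complete[OF i(2) j(2) i'(2) j'(2)])
    also have "\<dots> = of_nat (a * b) * of_bool (i = i' \<and> j = j')"
      using div_mod_eq_iff[of i b i'] div_mod_eq_iff[of j b j'] by (auto simp: of_bool_def)
    finally show ?thesis .
  qed
qed

text \<open>With X the bit flip and Z the phase flip, this is X^(k div 2) Z^(k mod 2) for
  \<open>k < 4\<close>; \<open>pauli 3\<close> is Y only up to a phase.\<close>

definition pauli :: "nat \<Rightarrow> complex mat" where
  "pauli k = mat 2 2 (\<lambda>(i, j). of_bool ((i = j) = (k div 2 = 0)) * (- 1) ^ (j * (k mod 2)))"

lemma lessThan_2: "{..<2} = {0, 1::nat}"
  by auto

lemma pauli_index: "i < 2 \<Longrightarrow> j < 2 \<Longrightarrow>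
    pauli k $$ (i, j) = of_bool ((i = j) = (k div 2 = 0)) * (- 1) ^ (j * (k mod 2))"
  by (simp add: pauli_def)

lemma pauli_carrier: "pauli k \<in> carrier_mat 2 2"
  by (simp add: pauli_def)

lemma error_basis_pauli: "error_basis 2 pauli"
proof
  have adj: "mat_adjoint (pauli k) \<in> carrier_mat 2 2" for k by (simp add: pauli_carrier)
  show "unitary_mat 2 (pauli k)" for k
  proof -
    have "mat_adjoint (pauli k) * pauli k = 1\<^sub>m 2"
    proof (rule eq_matI)
      fix i j assume "i < dim_row (1\<^sub>m 2 :: complex mat)" "j < dim_col (1\<^sub>m 2 :: complex mat)"
      then have ij: "i < 2" "j < 2" by auto
      show "(mat_adjoint (pauli k) * pauli k) $$ (i, j) = 1\<^sub>m 2 $$ (i, j)"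
        using less_2_cases[OF ij(1)] less_2_cases[OF ij(2)]
        by (auto simp: mult_mat_index[OF adj pauli_carrier ij] mat_adjoint_index[OF pauli_carrier] pauli_index lessThan_2
            power_mult_distrib[symmetric])
    qed (auto simp: pauli_def)
    moreover have "pauli k * mat_adjoint (pauli k) = 1\<^sub>m 2"
    proof (rule eq_matI)
      fix i j assume "i < dim_row (1\<^sub>m 2 :: complex mat)" "j < dim_col (1\<^sub>m 2 :: complex mat)"
      then have ij: "i < 2" "j < 2" by auto
      show "(pauli k * mat_adjoint (pauli k)) $$ (i, j) = 1\<^sub>m 2 $$ (i, j)"
        using less_2_cases[OF ij(1)] less_2_cases[OF ij(2)]
        by (auto simp: mult_mat_index[OF pauli_carrier adj ij] mat_adjoint_index[OF pauli_carrier] pauli_index lessThan_2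
            power_mult_distrib[symmetric])
    qed (auto simp: pauli_def)
    ultimately show ?thesis by (simp add: unitary_mat_def pauli_carrier)
  qed
  show "pauli 0 = 1\<^sub>m 2"
    by (rule eq_matI) (auto simp: pauli_def)
  show "\<exists>w. norm w = 1 \<and> pauli l * pauli k = w \<cdot>\<^sub>m (pauli k * pauli l)" if kl: "k < 2 * 2" "l < 2 * 2" for k l
  proof (intro exI conjI)
    have kl': "k = 0 \<or> k = 1 \<or> k = 2 \<or> k = 3" "l = 0 \<or> l = 1 \<or> l = 2 \<or> l = 3"
      using kl by auto
    \<comment> \<open>Moving Z past X costs a sign; the exponent counts these signs and is the
      symplectic product of the two Paulis.\<close>
    let ?w = "(- 1) ^ (k div 2 * (l mod 2) + l div 2 * (k mod 2)) :: complex"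
    show "norm ?w = 1" by (simp add: norm_power)
    show "pauli l * pauli k = ?w \<cdot>\<^sub>m (pauli k * pauli l)"
    proof (rule eq_matI)
      fix i j assume "i < dim_row (?w \<cdot>\<^sub>m (pauli k * pauli l))" "j < dim_col (?w \<cdot>\<^sub>m (pauli k * pauli l))"
      then have ij: "i < 2" "j < 2" by (auto simp: pauli_def)
      have "(pauli l * pauli k) $$ (i, j) = ?w * (pauli k * pauli l) $$ (i, j)"
        unfolding mult_mat_index[OF pauli_carrier pauli_carrier ij]
        using less_2_cases[OF ij(1)] less_2_cases[OF ij(2)] kl'
        by (elim disjE) (simp_all add: pauli_index lessThan_2)
      then show "(pauli l * pauli k) $$ (i, j) = (?w \<cdot>\<^sub>m (pauli k * pauli l)) $$ (i, j)"
        using ij by (simp add: pauli_def)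
    qed (auto simp: pauli_def)
  qed
  show "(\<Sum>k<2 * 2. cnj (pauli k $$ (i, j)) * pauli k $$ (i', j')) = of_nat 2 * of_bool (i = i' \<and> j = j')"
    if "i < 2" "j < 2" "i' < 2" "j' < 2" for i j i' j'
  proof -
    have "{..<2 * 2} = {0, 1, 2, 3::nat}" by auto
    with less_2_cases[OF that(1)] less_2_cases[OF that(2)] less_2_cases[OF that(3)] less_2_cases[OF that(4)]
    show ?thesis by (elim disjE) (simp_all add: pauli_index)
  qed
qed

text \<open>The base-4 digits of \<open>k\<close> select the one-qubit Paulis, with the leading
  digit for the first qubit.\<close>

fun qubit_pauli :: "nat \<Rightarrow> nat \<Rightarrow> complex mat" where
  "qubit_pauli 0 k = 1\<^sub>m 1"
| "qubit_pauli (Suc n) k = kron (pauli (k div (2 ^ n * 2 ^ n))) (qubit_pauli n (k mod (2 ^ n * 2 ^ n)))"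

lemma error_basis_qubit_pauli: "error_basis (2 ^ n) (qubit_pauli n)"
proof (induction n)
  case 0
  have "qubit_pauli 0 = (\<lambda>k. 1\<^sub>m 1)" by (rule ext) simp
  then show ?case using error_basis_one by simp
next
  case (Suc n)
  have "qubit_pauli (Suc n) = (\<lambda>k. kron (pauli (k div (2 ^ n * 2 ^ n))) (qubit_pauli n (k mod (2 ^ n * 2 ^ n))))"
    by (rule ext) simp
  then show ?case using error_basis_kron[OF error_basis_pauli Suc] by simp
qed

lemma qubitwise_unitary_qubit_pauli:
  "k < 2 ^ n * 2 ^ n \<Longrightarrow> qubitwise_unitary n (qubit_pauli n k)"
proof (induction n arbitrary: k)
  case (Suc n)
  then have "k < 2 * 2 * (2 ^ n * 2 ^ n)" by (simp add: mult_ac)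
  from div_mod_less[OF this] Suc.IH error_basis.unitary[OF error_basis_pauli]
  show ?case unfolding qubitwise_unitary_Suc qubit_pauli.simps by blast
qed (simp add: qubitwise_unitary_0)

subsection \<open>Applying a unitary under a Pauli encryption\<close>

lemma instrument_seq_family:
  assumes "instrument 1 1 D K P" "instrument 1 1 D' K' P'"
  shows "instrument 1 1 (D * D') (K * K') (\<lambda>\<alpha>. seq_op D' 1 (P' (\<alpha> mod K')) (P (\<alpha> div K')))"
  using instrument_seq[OF assms(1), of 1 D' K' "\<lambda>_. P'"] assms(2) by blast

context error_basis
begin

text \<open>The effect on Bob's register when Alice has no register of her own.\<close>

definition collapse :: "nat \<Rightarrow> (nat \<Rightarrow> nat \<Rightarrow> nat \<Rightarrow> complex) \<Rightarrow> (nat \<Rightarrow> nat \<Rightarrow> nat \<Rightarrow> complex) \<Rightarrow> complex mat" where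
  "collapse D P Q = joint_op 1 1 d d D P Q"

lemma collapse_carrier: "collapse D P Q \<in> carrier_mat d d"
  using joint_op_carrier[of 1 1 d d D P Q] by (simp add: collapse_def)

lemma collapse_index: "u < d \<Longrightarrow> s < d \<Longrightarrow> collapse D P Q $$ (u, s) = (\<Sum>x<D. P x 0 0 * Q x u s)"
  by (simp add: collapse_def joint_op_index)

lemma collapse_seq:
  "collapse (D1 * D2) (seq_op D2 1 P2 P1) (seq_op D2 d Q2 Q1) = collapse D2 P2 Q2 * collapse D1 P1 Q1"
  unfolding collapse_def by (rule joint_op_seq)

lemma collapse_measure: "y < D \<Longrightarrow> collapse D P (measure_op y) = P y 0 0 \<cdot>\<^sub>m 1\<^sub>m d"
  unfolding collapse_def by (rule joint_op_measure)

text \<open>An outcome succeeds if \<open>X\<close>, the effect on the state before its encryption, is \<open>R\<close> up to a Pauli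
and the amplitude \<open>c\<close>; failure is recorded by \<open>c = 0\<close>.\<close>

definition heralds :: "complex mat \<Rightarrow> complex \<Rightarrow> complex mat \<Rightarrow> bool" where
  "heralds R c X \<longleftrightarrow> c = 0 \<or> (\<exists>f<d * d. X = c \<cdot>\<^sub>m (\<sigma> f * R))"

lemma heralds_smult: "heralds R c X \<Longrightarrow> heralds R (a * c) (a \<cdot>\<^sub>m X)"
  by (auto simp: heralds_def smult_smult_mat_assoc)

text \<open>Bob's register is encrypted with \<open>\<sigma> k\<close>. Alice's instrument \<open>P k\<close> depends on \<open>k\<close>, but not on \<open>R\<close>;
Bob's instrument \<open>Q\<close> depends on \<open>R\<close>, but not on \<open>k\<close>.\<close>

definition achieves :: "complex mat \<Rightarrow> nat \<Rightarrow> nat \<Rightarrow> (nat \<Rightarrow> nat \<Rightarrow> nat \<Rightarrow> nat \<Rightarrow> nat \<Rightarrow> complex) \<Rightarrow>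
    nat \<Rightarrow> real \<Rightarrow> bool" where
  "achieves R D K P L \<epsilon> \<longleftrightarrow> (\<exists>Q c. instrument d d D L Q \<and> (\<forall>k<d * d.
     (\<forall>\<alpha><K. \<forall>\<beta><L. heralds R (c k \<alpha> \<beta>) (collapse D (P k \<alpha>) (Q \<beta>) * \<sigma> k)) \<and>
     real D * (1 - \<epsilon>) \<le> (\<Sum>\<alpha><K. \<Sum>\<beta><L. (norm (c k \<alpha> \<beta>))\<^sup>2)))"

section \<open>Padding, idle batches and the two trivial tasks\<close>

lemma achievesI:
  assumes "instrument d d D L Q"
    and "\<And>k \<alpha> \<beta>. k < d * d \<Longrightarrow> \<alpha> < K \<Longrightarrow> \<beta> < L \<Longrightarrow> heralds R (c k \<alpha> \<beta>) (collapse D (P k \<alpha>) (Q \<beta>) * \<sigma> k)"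
    and "\<And>k. k < d * d \<Longrightarrow> real D * (1 - \<epsilon>) \<le> (\<Sum>\<alpha><K. \<Sum>\<beta><L. (norm (c k \<alpha> \<beta>))\<^sup>2)"
  shows "achieves R D K P L \<epsilon>"
  unfolding achieves_def using assms by (intro exI[of _ Q] exI[of _ c]) simp

text \<open>Bob's instruments for different targets follow the same Bell measurement, so they must
  be given a common number of outcomes.\<close>

lemma achieves_pad:
  assumes "achieves R D K P L \<epsilon>" "L \<le> L'"
  shows "achieves R D K P L' \<epsilon>"
proof -
  obtain Q c where Q: "instrument d d D L Q"
    and h: "\<And>k \<alpha> \<beta>. k < d * d \<Longrightarrow> \<alpha> < K \<Longrightarrow> \<beta> < L \<Longrightarrow> heralds R (c k \<alpha> \<beta>) (collapse D (P k \<alpha>) (Q \<beta>) * \<sigma> k)"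
    and s: "\<And>k. k < d * d \<Longrightarrow> real D * (1 - \<epsilon>) \<le> (\<Sum>\<alpha><K. \<Sum>\<beta><L. (norm (c k \<alpha> \<beta>))\<^sup>2)"
    using assms(1) unfolding achieves_def by blast
  \<comment> \<open>The added outcomes never occur; amplitude 0 declares them failures and leaves
    the success weight unchanged.\<close>
  let ?c = "\<lambda>k \<alpha> \<beta>. if \<beta> < L then c k \<alpha> \<beta> else 0"
  let ?Q = "\<lambda>\<beta>. if \<beta> < L then Q \<beta> else (\<lambda>x u s. 0)"
  have "(\<Sum>\<beta><L'. (norm (?c k \<alpha> \<beta>))\<^sup>2) = (\<Sum>\<beta><L. (norm (c k \<alpha> \<beta>))\<^sup>2)" for k \<alpha>
    using assms(2) by (intro sum.mono_neutral_cong_right) auto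
  with s have "real D * (1 - \<epsilon>) \<le> (\<Sum>\<alpha><K. \<Sum>\<beta><L'. (norm (?c k \<alpha> \<beta>))\<^sup>2)" if "k < d * d" for k
    using that by simp
  moreover have "heralds R (?c k \<alpha> \<beta>) (collapse D (P k \<alpha>) (?Q \<beta>) * \<sigma> k)" if "k < d * d" "\<alpha> < K" for k \<alpha> \<beta>
    using h[OF that] by (auto simp: heralds_def)
  ultimately show ?thesis
    by (intro achievesI[OF instrument_pad[OF Q assms(2)], where c = ?c]) blast+
qed

text \<open>Bob works on the first batch and measures the second, on which Alice runs
  \<open>P'\<close> regardless. Her scalars there have total weight \<open>D'\<close>, exactly the
  factor by which the required bound grows.\<close>

lemma achieves_extend_right:
  assumes ach: "achieves R D K P L \<epsilon>" and P': "\<And>k. k < d * d \<Longrightarrow> instrument 1 1 D' K' (P' k)"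
  shows "achieves R (D * D') (K * K') (\<lambda>k \<alpha>. seq_op D' 1 (P' k (\<alpha> mod K')) (P k (\<alpha> div K'))) (L * D') \<epsilon>"
proof -
  obtain Q c where Q: "instrument d d D L Q"
    and h: "\<And>k \<alpha> \<beta>. k < d * d \<Longrightarrow> \<alpha> < K \<Longrightarrow> \<beta> < L \<Longrightarrow> heralds R (c k \<alpha> \<beta>) (collapse D (P k \<alpha>) (Q \<beta>) * \<sigma> k)"
    and s: "\<And>k. k < d * d \<Longrightarrow> real D * (1 - \<epsilon>) \<le> (\<Sum>\<alpha><K. \<Sum>\<beta><L. (norm (c k \<alpha> \<beta>))\<^sup>2)"
    using ach unfolding achieves_def by blast
  define Q' where "Q' = (\<lambda>\<beta>. seq_op D' d (measure_op (\<beta> mod D')) (Q (\<beta> div D')))"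
  define c' where "c' = (\<lambda>k \<alpha> \<beta>. P' k (\<alpha> mod K') (\<beta> mod D') 0 0 * c k (\<alpha> div K') (\<beta> div D'))"
  have "instrument d d (D * D') (L * D') Q'"
    unfolding Q'_def by (rule instrument_seq[OF Q instrument_measure])
  moreover have "heralds R (c' k \<alpha> \<beta>) (collapse (D * D') (seq_op D' 1 (P' k (\<alpha> mod K')) (P k (\<alpha> div K'))) (Q' \<beta>) * \<sigma> k)"
    if k: "k < d * d" and ab: "\<alpha> < K * K'" "\<beta> < L * D'" for k \<alpha> \<beta>
  proof -
    note a = div_mod_less[OF ab(1)] and b = div_mod_less[OF ab(2)]
    have "collapse (D * D') (seq_op D' 1 (P' k (\<alpha> mod K')) (P k (\<alpha> div K'))) (Q' \<beta>) * \<sigma> k =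
      P' k (\<alpha> mod K') (\<beta> mod D') 0 0 \<cdot>\<^sub>m (collapse D (P k (\<alpha> div K')) (Q (\<beta> div D')) * \<sigma> k)"
      using carrier[OF k] collapse_carrier[of D]
      unfolding Q'_def collapse_seq
      by (simp add: left_mult_one_mat[of _ d d] right_mult_one_mat[of _ d d] collapse_measure[OF b(2)] mult_smult_assoc_mat[of _ d d _ d])
    then show ?thesis
      using heralds_smult[OF h[OF k a(1) b(1)]] by (simp add: c'_def)
  qed
  moreover have "real (D * D') * (1 - \<epsilon>) \<le> (\<Sum>\<alpha><K * K'. \<Sum>\<beta><L * D'. (norm (c' k \<alpha> \<beta>))\<^sup>2)" if k: "k < d * d" for k
  proof -
    have "(\<Sum>\<alpha><K * K'. \<Sum>\<beta><L * D'. (norm (c' k \<alpha> \<beta>))\<^sup>2) =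
      (\<Sum>i<K. \<Sum>i'<K'. \<Sum>j<L. \<Sum>y<D'. (norm (P' k i' y 0 0))\<^sup>2 * (norm (c k i j))\<^sup>2)"
      unfolding sum_prod_index by (intro sum.cong refl) (simp add: c'_def norm_mult power_mult_distrib)
    also have "\<dots> = (\<Sum>i<K. \<Sum>j<L. \<Sum>i'<K'. \<Sum>y<D'. (norm (P' k i' y 0 0))\<^sup>2 * (norm (c k i j))\<^sup>2)"
      by (rule sum.cong[OF refl], rule sum.swap)
    also have "\<dots> = (\<Sum>i<K. \<Sum>j<L. (\<Sum>y<D'. \<Sum>i'<K'. (norm (P' k i' y 0 0))\<^sup>2) * (norm (c k i j))\<^sup>2)"
      unfolding sum_distrib_right by (rule sum.cong[OF refl], rule sum.cong[OF refl], rule sum.swap)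
    also have "\<dots> = real D' * (\<Sum>i<K. \<Sum>j<L. (norm (c k i j))\<^sup>2)"
      using instrument_sum_norm[OF P'[OF k]] by (simp add: sum_distrib_left)
    finally show ?thesis using mult_left_mono[OF s[OF k], of "real D'"] by (simp add: mult_ac)
  qed
  ultimately show ?thesis by (intro achievesI[where Q = Q' and c = c'])
qed

text \<open>The mirror image: Bob measures the first batch and works on the second.\<close>

lemma achieves_extend_left:
  assumes P: "\<And>k. k < d * d \<Longrightarrow> instrument 1 1 D K (P k)" and ach: "achieves R D' K' P' L \<epsilon>"
  shows "achieves R (D * D') (K * K') (\<lambda>k \<alpha>. seq_op D' 1 (P' k (\<alpha> mod K')) (P k (\<alpha> div K'))) (D * L) \<epsilon>"
proof -
  obtain Q c where Q: "instrument d d D' L Q"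
    and h: "\<And>k \<alpha> \<beta>. k < d * d \<Longrightarrow> \<alpha> < K' \<Longrightarrow> \<beta> < L \<Longrightarrow> heralds R (c k \<alpha> \<beta>) (collapse D' (P' k \<alpha>) (Q \<beta>) * \<sigma> k)"
    and s: "\<And>k. k < d * d \<Longrightarrow> real D' * (1 - \<epsilon>) \<le> (\<Sum>\<alpha><K'. \<Sum>\<beta><L. (norm (c k \<alpha> \<beta>))\<^sup>2)"
    using ach unfolding achieves_def by blast
  define Q' where "Q' = (\<lambda>\<beta>. seq_op D' d (Q (\<beta> mod L)) (measure_op (\<beta> div L)))"
  define c' where "c' = (\<lambda>k \<alpha> \<beta>. P k (\<alpha> div K') (\<beta> div L) 0 0 * c k (\<alpha> mod K') (\<beta> mod L))"
  have "instrument d d (D * D') (D * L) Q'"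
    unfolding Q'_def by (rule instrument_seq[OF instrument_measure Q])
  moreover have "heralds R (c' k \<alpha> \<beta>) (collapse (D * D') (seq_op D' 1 (P' k (\<alpha> mod K')) (P k (\<alpha> div K'))) (Q' \<beta>) * \<sigma> k)"
    if k: "k < d * d" and ab: "\<alpha> < K * K'" "\<beta> < D * L" for k \<alpha> \<beta>
  proof -
    note a = div_mod_less[OF ab(1)] and b = div_mod_less[OF ab(2)]
    have "collapse (D * D') (seq_op D' 1 (P' k (\<alpha> mod K')) (P k (\<alpha> div K'))) (Q' \<beta>) * \<sigma> k =
      P k (\<alpha> div K') (\<beta> div L) 0 0 \<cdot>\<^sub>m (collapse D' (P' k (\<alpha> mod K')) (Q (\<beta> mod L)) * \<sigma> k)"
      using carrier[OF k] collapse_carrier[of D']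
      unfolding Q'_def collapse_seq
      by (simp add: left_mult_one_mat[of _ d d] right_mult_one_mat[of _ d d] collapse_measure[OF b(1)] mult_smult_assoc_mat[of _ d d _ d]
          mult_smult_distrib[of _ d d _ d])
    then show ?thesis
      using heralds_smult[OF h[OF k a(2) b(2)]] by (simp add: c'_def)
  qed
  moreover have "real (D * D') * (1 - \<epsilon>) \<le> (\<Sum>\<alpha><K * K'. \<Sum>\<beta><D * L. (norm (c' k \<alpha> \<beta>))\<^sup>2)" if k: "k < d * d" for k
  proof -
    have "(\<Sum>\<alpha><K * K'. \<Sum>\<beta><D * L. (norm (c' k \<alpha> \<beta>))\<^sup>2) =
      (\<Sum>i<K. \<Sum>i'<K'. \<Sum>y<D. \<Sum>j<L. (norm (P k i y 0 0))\<^sup>2 * (norm (c k i' j))\<^sup>2)"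
      unfolding sum_prod_index by (intro sum.cong refl) (simp add: c'_def norm_mult power_mult_distrib)
    also have "\<dots> = (\<Sum>i<K. \<Sum>y<D. \<Sum>i'<K'. \<Sum>j<L. (norm (P k i y 0 0))\<^sup>2 * (norm (c k i' j))\<^sup>2)"
      by (rule sum.cong[OF refl], rule sum.swap)
    also have "\<dots> = (\<Sum>y<D. \<Sum>i<K. \<Sum>i'<K'. \<Sum>j<L. (norm (P k i y 0 0))\<^sup>2 * (norm (c k i' j))\<^sup>2)"
      by (rule sum.swap)
    also have "\<dots> = (\<Sum>y<D. \<Sum>i<K. (norm (P k i y 0 0))\<^sup>2) * (\<Sum>i'<K'. \<Sum>j<L. (norm (c k i' j))\<^sup>2)"
      by (simp only: sum_distrib_left[symmetric] sum_distrib_right[symmetric])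
    also have "\<dots> = real D * (\<Sum>i<K'. \<Sum>j<L. (norm (c k i j))\<^sup>2)"
      using instrument_sum_norm[OF P[OF k]] by simp
    finally show ?thesis using mult_left_mono[OF s[OF k], of "real D"] by (simp add: mult_ac)
  qed
  ultimately show ?thesis by (intro achievesI[where Q = Q' and c = c'])
qed

text \<open>The encryption \<open>\<sigma> k\<close> is itself an admissible Pauli in
  \<open>heralds\<close>, so for the identity Bob may discard the batch without loss. This covers
  the lucky outcome of a round.\<close>

lemma achieves_one:
  assumes P: "\<And>k. k < d * d \<Longrightarrow> instrument 1 1 D K (P k)"
  shows "achieves (1\<^sub>m d) D K P D 0"
proof -
  have "heralds (1\<^sub>m d) (P k \<alpha> \<beta> 0 0) (collapse D (P k \<alpha>) (measure_op \<beta>) * \<sigma> k)"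
    if "k < d * d" "\<beta> < D" for k \<alpha> \<beta>
    using carrier[OF that(1)] that
    by (auto simp: heralds_def collapse_measure mult_smult_assoc_mat[of _ d d _ d])
  moreover have "real D * (1 - 0) \<le> (\<Sum>\<alpha><K. \<Sum>\<beta><D. (norm (P k \<alpha> \<beta> 0 0))\<^sup>2)" if "k < d * d" for k
    using instrument_sum_norm[OF P[OF that]] by (subst sum.swap) simp
  ultimately show ?thesis
    by (intro achievesI[OF instrument_measure, where c = "\<lambda>k \<alpha> \<beta>. P k \<alpha> \<beta> 0 0"])
qed

text \<open>All outcomes may be declared failures; this is where the recursion over rounds
  starts.\<close>

lemma achieves_trivial: "achieves R D K P D 1"
  unfolding achieves_def heralds_def
  by (intro exI[of _ measure_op] exI[of _ "\<lambda>_ _ _. 0"]) (simp add: instrument_measure)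

text \<open>Alice's side of one round: of the basis state \<open>y\<close>, \<open>y div d\<close> is her half of the pairs through which
she receives Bob's register, and \<open>y mod d\<close> her half of those through which she returns it. She applies
\<open>T\<close> in between and obtains the Bell outcome \<open>k\<close>.\<close>

definition teleport :: "complex mat \<Rightarrow> nat \<Rightarrow> nat \<Rightarrow> nat \<Rightarrow> nat \<Rightarrow> complex" where
  "teleport T k = (\<lambda>y u s. complex_of_real (1 / sqrt d) * (\<sigma> k * T) $$ (y mod d, y div d))"

text \<open>Bob's side of the round: his register is measured jointly with the half
  \<open>y div d\<close>, and the half \<open>y mod d\<close>, through which Alice returns the
  state, becomes his register.\<close>

definition bell_measure :: "nat \<Rightarrow> nat \<Rightarrow> nat \<Rightarrow> nat \<Rightarrow> complex" where
  "bell_measure l = (\<lambda>y v s. complex_of_real (1 / sqrt d) * of_bool (v = y mod d) * \<sigma> l $$ (y div d, s))"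

lemma sqrt_mult_self: "complex_of_real (1 / sqrt d) * complex_of_real (1 / sqrt d) = 1 / of_nat d"
proof -
  have "complex_of_real (1 / sqrt d) * complex_of_real (1 / sqrt d) = complex_of_real (1 / (sqrt d * sqrt d))"
    by (simp only: of_real_mult[symmetric] times_divide_times_eq mult_1)
  then show ?thesis by simp
qed

text \<open>Completeness survives right multiplication by a unitary, as the inner sum leaves entries
  of \<open>mat_adjoint T * T\<close>. So Alice's gate can be merged into her Bell
  measurement.\<close>

lemma complete_mult:
  assumes T: "unitary_mat d T" and b: "b < d" "b' < d" and a: "a < d" "a' < d"
  shows "(\<Sum>k<d * d. cnj ((\<sigma> k * T) $$ (b, a)) * (\<sigma> k * T) $$ (b', a')) = of_nat d * of_bool (b = b' \<and> a = a')"
proof -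
  note cT = unitary_mat_carrier[OF T]
  have cT': "mat_adjoint T \<in> carrier_mat d d" using cT by simp
  have "(\<Sum>k<d * d. cnj ((\<sigma> k * T) $$ (b, a)) * (\<sigma> k * T) $$ (b', a')) =
    (\<Sum>k<d * d. \<Sum>e<d. \<Sum>e'<d. cnj (\<sigma> k $$ (b, e) * T $$ (e, a)) * (\<sigma> k $$ (b', e') * T $$ (e', a')))"
    by (intro sum.cong refl)
      (simp only: lessThan_iff mult_mat_index[OF carrier cT] b a cnj_sum sum_product)
  also have "\<dots> = (\<Sum>e<d. \<Sum>k<d * d. \<Sum>e'<d. cnj (\<sigma> k $$ (b, e) * T $$ (e, a)) * (\<sigma> k $$ (b', e') * T $$ (e', a')))"
    by (rule sum.swap)
  also have "\<dots> = (\<Sum>e<d. \<Sum>e'<d. \<Sum>k<d * d. cnj (\<sigma> k $$ (b, e) * T $$ (e, a)) * (\<sigma> k $$ (b', e') * T $$ (e', a')))"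
    by (rule sum.cong[OF refl], rule sum.swap)
  also have "\<dots> = (\<Sum>e<d. \<Sum>e'<d. cnj (T $$ (e, a)) * T $$ (e', a') * (\<Sum>k<d * d. cnj (\<sigma> k $$ (b, e)) * \<sigma> k $$ (b', e')))"
    by (simp add: sum_distrib_left mult_ac)
  also have "\<dots> = (\<Sum>e<d. \<Sum>e'<d. cnj (T $$ (e, a)) * T $$ (e', a') * (of_nat d * of_bool (b = b' \<and> e = e')))"
    by (intro sum.cong refl) (simp add: complete b)
  also have "\<dots> = (\<Sum>e<d. of_nat d * of_bool (b = b') * (cnj (T $$ (e, a)) * T $$ (e, a')))"
    by (intro sum.cong refl) (cases "b = b'"; simp add: mult.assoc[symmetric] sum_of_bool_mult_lessThan)
  also have "\<dots> = of_nat d * of_bool (b = b') * (mat_adjoint T * T) $$ (a, a')"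
    by (simp add: mult_mat_index[OF cT' cT] a mat_adjoint_index[OF cT] sum_distrib_left del: index_mult_mat)
  also have "\<dots> = of_nat d * of_bool (b = b' \<and> a = a')"
    using T a by (auto simp: unitary_mat_def of_bool_def)
  finally show ?thesis .
qed

lemma instrument_teleport:
  assumes T: "unitary_mat d T"
  shows "instrument 1 1 (d * d) (d * d) (teleport T)"
  unfolding instrument_def
proof (intro allI impI)
  fix x y s t :: nat assume xy: "x < d * d" "y < d * d" and st: "s < 1" "t < 1"
  note x = div_mod_less[OF xy(1)] and y = div_mod_less[OF xy(2)]
  have "(\<Sum>k<d * d. \<Sum>u<1. cnj (teleport T k x u s) * teleport T k y u t) =
      (complex_of_real (1 / sqrt d) * complex_of_real (1 / sqrt d)) *
      (\<Sum>k<d * d. cnj ((\<sigma> k * T) $$ (x mod d, x div d)) * (\<sigma> k * T) $$ (y mod d, y div d))"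
    unfolding sum_distrib_left by (intro sum.cong refl) (simp add: teleport_def mult_ac del: index_mult_mat)
  also have "\<dots> = of_bool (x mod d = y mod d \<and> x div d = y div d)"
    unfolding sqrt_mult_self complete_mult[OF T x(2) y(2) x(1) y(1)] using dim_pos[OF xy(1)] by simp
  also have "\<dots> = of_bool (x = y \<and> s = t)"
    using div_mod_eq_iff[of x d y] st by auto
  finally show "(\<Sum>k<d * d. \<Sum>u<1. cnj (teleport T k x u s) * teleport T k y u t) = of_bool (x = y \<and> s = t)" .
qed

lemma instrument_bell_measure: "instrument d d (d * d) (d * d) bell_measure"
  unfolding instrument_def
proof (intro allI impI)
  fix x y s t assume xy: "x < d * d" "y < d * d" and st: "s < d" "t < d"
  note x = div_mod_less[OF xy(1)] and y = div_mod_less[OF xy(2)]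
  have "(\<Sum>l<d * d. \<Sum>u<d. cnj (bell_measure l x u s) * bell_measure l y u t) =
      (\<Sum>l<d * d. (complex_of_real (1 / sqrt d) * complex_of_real (1 / sqrt d)) *
        (cnj (\<sigma> l $$ (x div d, s)) * \<sigma> l $$ (y div d, t)) *
        (\<Sum>u<d. of_bool (u = x mod d) * of_bool (u = y mod d)))"
    unfolding sum_distrib_left by (intro sum.cong refl) (simp add: bell_measure_def mult_ac)
  also have "\<dots> = (complex_of_real (1 / sqrt d) * complex_of_real (1 / sqrt d)) * of_bool (x mod d = y mod d) *
      (\<Sum>l<d * d. cnj (\<sigma> l $$ (x div d, s)) * \<sigma> l $$ (y div d, t))"
    using x y by (simp only: sum_of_bool_mult_lessThan if_True sum_distrib_left mult_ac)
  also have "\<dots> = of_bool (x mod d = y mod d) * of_bool (x div d = y div d \<and> s = t)"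
    unfolding sqrt_mult_self complete[OF x(1) st(1) y(1) st(2)] using dim_pos[OF xy(1)] by simp
  also have "\<dots> = of_bool (x = y \<and> s = t)"
    using div_mod_eq_iff[of x d y] by auto
  finally show "(\<Sum>l<d * d. \<Sum>u<d. cnj (bell_measure l x u s) * bell_measure l y u t) = of_bool (x = y \<and> s = t)" .
qed

text \<open>Bob's byproduct, Alice's gate and her byproduct act in this order, and each Bell
  measurement contributes \<open>1 / sqrt d\<close>. With the postponed normalisation, for unitary
  \<open>T\<close> every pair of outcomes has probability 1/d^4.\<close>

lemma collapse_teleport:
  assumes T: "T \<in> carrier_mat d d" and k: "k < d * d" and l: "l < d * d"
  shows "collapse (d * d) (teleport T k) (bell_measure l) = (1 / of_nat d) \<cdot>\<^sub>m (\<sigma> k * T * \<sigma> l)"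
proof (rule eq_matI)
  have kT: "\<sigma> k * T \<in> carrier_mat d d" using carrier[OF k] T by simp
  have c: "\<sigma> k * T * \<sigma> l \<in> carrier_mat d d" using carrier[OF l] kT by simp
  fix u s assume "u < dim_row ((1 / of_nat d) \<cdot>\<^sub>m (\<sigma> k * T * \<sigma> l))" "s < dim_col ((1 / of_nat d) \<cdot>\<^sub>m (\<sigma> k * T * \<sigma> l))"
  then have us: "u < d" "s < d" using c by auto
  have "collapse (d * d) (teleport T k) (bell_measure l) $$ (u, s) =
      (\<Sum>a<d. \<Sum>b<d. of_bool (u = b) * ((complex_of_real (1 / sqrt d) * complex_of_real (1 / sqrt d)) *
        ((\<sigma> k * T) $$ (b, a) * \<sigma> l $$ (a, s))))"
    unfolding collapse_index[OF us] sum_prod_index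
    by (intro sum.cong refl) (simp add: teleport_def bell_measure_def mult_ac del: index_mult_mat)
  also have "\<dots> = (1 / of_nat d) * (\<Sum>a<d. (\<sigma> k * T) $$ (u, a) * \<sigma> l $$ (a, s))"
    using us by (simp only: sum_of_bool_mult_lessThan if_True sqrt_mult_self sum_distrib_left)
  also have "\<dots> = ((1 / of_nat d) \<cdot>\<^sub>m (\<sigma> k * T * \<sigma> l)) $$ (u, s)"
    using us carrier[OF k] carrier[OF l] unfolding mult_mat_index[OF kT carrier[OF l] us, symmetric] by simp
  finally show "collapse (d * d) (teleport T k) (bell_measure l) $$ (u, s) = ((1 / of_nat d) \<cdot>\<^sub>m (\<sigma> k * T * \<sigma> l)) $$ (u, s)" .
qed (use collapse_carrier[of "d * d" "teleport T k" "bell_measure l"] carrier[OF k] carrier[OF l] T in auto)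

text \<open>Bob's outcomes are equally likely, so the failure probability of a round is the mean of
  the \<open>\<epsilon> l\<close>. They may differ, because outcome 0 leaves nothing to correct and
  gets error 0.\<close>

lemma achieves_step:
  assumes R: "unitary_mat d R"
    and P: "\<And>k. k < d * d \<Longrightarrow> instrument 1 1 D K (P k)"
    and ach: "\<And>l. l < d * d \<Longrightarrow> achieves (R * mat_adjoint (\<sigma> l) * mat_adjoint R) D K P L (\<epsilon> l)"
    and \<eta>: "real (d * d) * (1 - \<eta>) \<le> (\<Sum>l<d * d. 1 - \<epsilon> l)"
  shows "\<exists>K' P' L'. (\<forall>k<d * d. instrument 1 1 (d * d * D) K' (P' k)) \<and> achieves R (d * d * D) K' P' L' \<eta>"
proof -
  define T where "T = (\<lambda>k. R * mat_adjoint (\<sigma> k))"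
  have T: "unitary_mat d (T k)" if "k < d * d" for k
    unfolding T_def by (intro unitary_mat_mult R unitary_mat_adjoint unitary that)
  have "\<forall>l\<in>{..<d * d}. \<exists>Q c. instrument d d D L Q \<and> (\<forall>k<d * d. (\<forall>\<alpha><K. \<forall>\<beta><L.
      heralds (R * mat_adjoint (\<sigma> l) * mat_adjoint R) (c k \<alpha> \<beta>) (collapse D (P k \<alpha>) (Q \<beta>) * \<sigma> k)) \<and>
      real D * (1 - \<epsilon> l) \<le> (\<Sum>\<alpha><K. \<Sum>\<beta><L. (norm (c k \<alpha> \<beta>))\<^sup>2))"
    using ach by (simp add: achieves_def)
  from bchoice[OF this] obtain Q where "\<forall>l\<in>{..<d * d}. \<exists>c. instrument d d D L (Q l) \<and> (\<forall>k<d * d. (\<forall>\<alpha><K. \<forall>\<beta><L.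
      heralds (R * mat_adjoint (\<sigma> l) * mat_adjoint R) (c k \<alpha> \<beta>) (collapse D (P k \<alpha>) (Q l \<beta>) * \<sigma> k)) \<and>
      real D * (1 - \<epsilon> l) \<le> (\<Sum>\<alpha><K. \<Sum>\<beta><L. (norm (c k \<alpha> \<beta>))\<^sup>2))" by blast
  from bchoice[OF this] obtain c where Qc: "\<forall>l\<in>{..<d * d}. instrument d d D L (Q l) \<and> (\<forall>k<d * d. (\<forall>\<alpha><K. \<forall>\<beta><L.
      heralds (R * mat_adjoint (\<sigma> l) * mat_adjoint R) (c l k \<alpha> \<beta>) (collapse D (P k \<alpha>) (Q l \<beta>) * \<sigma> k)) \<and>
      real D * (1 - \<epsilon> l) \<le> (\<Sum>\<alpha><K. \<Sum>\<beta><L. (norm (c l k \<alpha> \<beta>))\<^sup>2))" by blast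
  have "\<forall>k\<in>{..<d * d}. \<forall>l\<in>{..<d * d}. \<exists>w. norm w = 1 \<and> \<sigma> l * \<sigma> k = w \<cdot>\<^sub>m (\<sigma> k * \<sigma> l)"
    using commute by simp
  then obtain w where w: "\<And>k l. k < d * d \<Longrightarrow> l < d * d \<Longrightarrow> norm (w k l) = 1 \<and> \<sigma> l * \<sigma> k = w k l \<cdot>\<^sub>m (\<sigma> k * \<sigma> l)"
    by (metis lessThan_iff)
  \<comment> \<open>Alice's old key enters only through \<open>T k\<close>. The rest of her protocol
    runs on her new key \<open>\<alpha> div K\<close>, and Bob's on the plan for his outcome
    \<open>\<beta> div L\<close>.\<close>
  define P' where "P' = (\<lambda>k \<alpha>. seq_op D 1 (P (\<alpha> div K) (\<alpha> mod K)) (teleport (T k) (\<alpha> div K)))"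
  define Q' where "Q' = (\<lambda>\<beta>. seq_op D d (Q (\<beta> div L) (\<beta> mod L)) (bell_measure (\<beta> div L)))"
  define c' where "c' = (\<lambda>k \<alpha> \<beta>. w k (\<beta> div L) / of_nat d * c (\<beta> div L) (\<alpha> div K) (\<alpha> mod K) (\<beta> mod L))"
  have "instrument 1 1 (d * d * D) (d * d * K) (P' k)" if "k < d * d" for k
    unfolding P'_def by (rule instrument_seq[OF instrument_teleport[OF T[OF that]] P])
  moreover have "achieves R (d * d * D) (d * d * K) P' (d * d * L) \<eta>"
  proof (rule achievesI[where Q = Q' and c = c'])
    show "instrument d d (d * d * D) (d * d * L) Q'"
      unfolding Q'_def using Qc by (intro instrument_seq[OF instrument_bell_measure]) simp
  next
    fix k \<alpha> \<beta> assume k: "k < d * d" and ab: "\<alpha> < d * d * K" "\<beta> < d * d * L"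
    note a = div_mod_less[OF ab(1)] and b = div_mod_less[OF ab(2)]
    let ?k' = "\<alpha> div K" and ?l = "\<beta> div L"
    let ?C = "collapse D (P ?k' (\<alpha> mod K)) (Q ?l (\<beta> mod L))"
    let ?c = "c ?l ?k' (\<alpha> mod K) (\<beta> mod L)"
    note cc = collapse_carrier[of D "P ?k' (\<alpha> mod K)" "Q ?l (\<beta> mod L)"] carrier[OF k] carrier[OF a(1)] carrier[OF b(1)]
      unitary_mat_carrier[OF R]
    have adj: "mat_adjoint (\<sigma> k) \<in> carrier_mat d d" "mat_adjoint (\<sigma> ?l) \<in> carrier_mat d d" "mat_adjoint R \<in> carrier_mat d d"
      using cc by simp_all
    note mc = mult_carrier_mat[of _ d d _ d]
    note assoc = assoc_mult_mat[of _ d d _ d _ d]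
    \<comment> \<open>Alice decrypts only after Bob's byproduct has been applied; this still removes
      the old key, because the two Paulis commute up to \<open>w k ?l\<close>.\<close>
    have conj: "mat_adjoint (\<sigma> k) * (\<sigma> ?l * \<sigma> k) = w k ?l \<cdot>\<^sub>m \<sigma> ?l"
    proof -
      have "mat_adjoint (\<sigma> k) * (\<sigma> k * \<sigma> ?l) = \<sigma> ?l"
        by (rule unitary_mat_cancel[OF unitary[OF k] cc(4)])
      then show ?thesis
        using w[OF k b(1)] cc adj by (simp add: mult_smult_distrib[of _ d d _ d] mc)
    qed
    have "collapse (d * d * D) (P' k \<alpha>) (Q' \<beta>) * \<sigma> k =
        ?C * ((1 / of_nat d) \<cdot>\<^sub>m (\<sigma> ?k' * T k * \<sigma> ?l)) * \<sigma> k"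
      unfolding P'_def Q'_def collapse_seq collapse_teleport[OF unitary_mat_carrier[OF T[OF k]] a(1) b(1)] ..
    also have "\<dots> = (1 / of_nat d) \<cdot>\<^sub>m ((?C * \<sigma> ?k') * (R * (mat_adjoint (\<sigma> k) * (\<sigma> ?l * \<sigma> k))))"
      using cc adj unfolding T_def
      by (simp add: mult_smult_distrib[of _ d d _ d] mult_smult_assoc_mat[of _ d d _ d] assoc mc)
    also have "\<dots> = (w k ?l / of_nat d) \<cdot>\<^sub>m ((?C * \<sigma> ?k') * (R * \<sigma> ?l))"
      unfolding conj using cc
      by (simp add: mult_smult_distrib[of _ d d _ d] smult_smult_mat_assoc mc)
    finally have eq: "collapse (d * d * D) (P' k \<alpha>) (Q' \<beta>) * \<sigma> k = (w k ?l / of_nat d) \<cdot>\<^sub>m ((?C * \<sigma> ?k') * (R * \<sigma> ?l))" .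
    have "heralds (R * mat_adjoint (\<sigma> ?l) * mat_adjoint R) ?c (?C * \<sigma> ?k')"
      using Qc a b by simp
    then show "heralds R (c' k \<alpha> \<beta>) (collapse (d * d * D) (P' k \<alpha>) (Q' \<beta>) * \<sigma> k)"
      unfolding heralds_def
    proof (elim disjE exE conjE)
      fix f assume f: "f < d * d" "?C * \<sigma> ?k' = ?c \<cdot>\<^sub>m (\<sigma> f * (R * mat_adjoint (\<sigma> ?l) * mat_adjoint R))"
      \<comment> \<open>The correction is the unitary that turns \<open>R * \<sigma> ?l\<close>,
        which has been applied already, into \<open>R\<close>.\<close>
      have cancel: "R * mat_adjoint (\<sigma> ?l) * mat_adjoint R * (R * \<sigma> ?l) = R"
      proof -
        have "R * mat_adjoint (\<sigma> ?l) * mat_adjoint R * (R * \<sigma> ?l) = R * (mat_adjoint (\<sigma> ?l) * (mat_adjoint R * (R * \<sigma> ?l)))"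
          using cc adj by (simp add: assoc mc)
        also have "\<dots> = R * (mat_adjoint (\<sigma> ?l) * \<sigma> ?l)"
          by (simp only: unitary_mat_cancel[OF R cc(4)])
        also have "\<dots> = R"
          using unitary[OF b(1)] cc by (simp add: unitary_mat_def)
        finally show ?thesis .
      qed
      have "(?C * \<sigma> ?k') * (R * \<sigma> ?l) = ?c \<cdot>\<^sub>m (\<sigma> f * (R * mat_adjoint (\<sigma> ?l) * mat_adjoint R * (R * \<sigma> ?l)))"
        unfolding f(2) using cc adj carrier[OF f(1)]
        by (simp add: mult_smult_assoc_mat[of _ d d _ d] assoc mc)
      then show "c' k \<alpha> \<beta> = 0 \<or> (\<exists>f<d * d. collapse (d * d * D) (P' k \<alpha>) (Q' \<beta>) * \<sigma> k = c' k \<alpha> \<beta> \<cdot>\<^sub>m (\<sigma> f * R))"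
        unfolding eq cancel c'_def using f(1) by (auto simp: smult_smult_mat_assoc)
    qed (simp add: c'_def)
  next
    fix k assume k: "k < d * d"
    then have d: "d > 0" by (rule dim_pos)
    \<comment> \<open>The amplitude \<open>1 / d\<close> of the round gives the weight 1/d^2, which
      the \<open>d * d\<close> values of Alice's outcome \<open>k'\<close> make up for.\<close>
    have "(\<Sum>\<alpha><d * d * K. \<Sum>\<beta><d * d * L. (norm (c' k \<alpha> \<beta>))\<^sup>2) =
      (\<Sum>k'<d * d. \<Sum>\<alpha><K. \<Sum>l<d * d. \<Sum>\<beta><L. (norm (c l k' \<alpha> \<beta>))\<^sup>2 / real (d * d))"
      unfolding sum_prod_index[of _ "d * d"]
      using w[OF k] by (intro sum.cong refl)
        (simp add: c'_def norm_mult norm_divide power_mult_distrib power_divide power2_eq_square)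
    also have "\<dots> = (\<Sum>k'<d * d. \<Sum>l<d * d. \<Sum>\<alpha><K. \<Sum>\<beta><L. (norm (c l k' \<alpha> \<beta>))\<^sup>2 / real (d * d))"
      by (rule sum.cong[OF refl], rule sum.swap)
    also have "\<dots> = (\<Sum>k'<d * d. \<Sum>l<d * d. (\<Sum>\<alpha><K. \<Sum>\<beta><L. (norm (c l k' \<alpha> \<beta>))\<^sup>2) / real (d * d))"
      by (simp only: sum_divide_distrib)
    also have "\<dots> \<ge> (\<Sum>k'<d * d. \<Sum>l<d * d. real D * (1 - \<epsilon> l) / real (d * d))"
      using Qc by (intro sum_mono divide_right_mono) auto
    also have "(\<Sum>k'<d * d. \<Sum>l<d * d. real D * (1 - \<epsilon> l) / real (d * d)) = real D * (\<Sum>l<d * d. 1 - \<epsilon> l)"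
      using d by (simp add: sum_divide_distrib[symmetric] sum_distrib_left[symmetric])
    finally have "real D * (\<Sum>l<d * d. 1 - \<epsilon> l) \<le> (\<Sum>\<alpha><d * d * K. \<Sum>\<beta><d * d * L. (norm (c' k \<alpha> \<beta>))\<^sup>2)" .
    moreover have "real (d * d * D) * (1 - \<eta>) \<le> real D * (\<Sum>l<d * d. 1 - \<epsilon> l)"
      using mult_left_mono[OF \<eta>, of "real D"] by (simp add: mult_ac)
    ultimately show "real (d * d * D) * (1 - \<eta>) \<le> (\<Sum>\<alpha><d * d * K. \<Sum>\<beta><d * d * L. (norm (c' k \<alpha> \<beta>))\<^sup>2)"
      by linarith
  qed
  ultimately show ?thesis by blast
qed

text \<open>One instrument of Alice serves all the unitaries in \<open>S\<close>.\<close>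

definition achievable :: "complex mat set \<Rightarrow> real \<Rightarrow> nat \<Rightarrow> bool" where
  "achievable S \<epsilon> e \<longleftrightarrow> (\<exists>K P L. (\<forall>k<d * d. instrument 1 1 (2 ^ e) K (P k)) \<and>
     (\<forall>R\<in>S. achieves R (2 ^ e) K P L \<epsilon>))"

lemma achievable_empty: "achievable {} \<epsilon> e"
  unfolding achievable_def
  by (intro exI[of _ "2 ^ e"] exI[of _ "\<lambda>k. measure_op"]) (simp add: instrument_measure)

text \<open>Alice runs both batches under the same key, for which she need not know the unitary that
  Bob wants; he discards the other batch. The maximum \<open>?L\<close> gives both cases the same
  number of outcomes.\<close>

lemma achievable_Un:
  assumes "achievable S \<epsilon> e" "achievable S' \<epsilon> e'"
  shows "achievable (S \<union> S') \<epsilon> (e + e')"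
proof -
  obtain K P L where P: "\<And>k. k < d * d \<Longrightarrow> instrument 1 1 (2 ^ e) K (P k)"
    and ach: "\<And>R. R \<in> S \<Longrightarrow> achieves R (2 ^ e) K P L \<epsilon>"
    using assms(1) unfolding achievable_def by blast
  obtain K' P' L' where P': "\<And>k. k < d * d \<Longrightarrow> instrument 1 1 (2 ^ e') K' (P' k)"
    and ach': "\<And>R. R \<in> S' \<Longrightarrow> achieves R (2 ^ e') K' P' L' \<epsilon>"
    using assms(2) unfolding achievable_def by blast
  let ?P = "\<lambda>k \<alpha>. seq_op (2 ^ e') 1 (P' k (\<alpha> mod K')) (P k (\<alpha> div K'))"
  let ?L = "max (L * 2 ^ e') (2 ^ e * L')"
  have 1: "achieves R (2 ^ e * 2 ^ e') (K * K') ?P ?L \<epsilon>" if "R \<in> S" for R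
    by (rule achieves_pad[OF achieves_extend_right[OF ach[OF that] P'] max.cobounded1])
  have 2: "achieves R (2 ^ e * 2 ^ e') (K * K') ?P ?L \<epsilon>" if "R \<in> S'" for R
    by (rule achieves_pad[OF achieves_extend_left[OF P ach'[OF that]] max.cobounded2])
  have 3: "instrument 1 1 (2 ^ e * 2 ^ e') (K * K') (?P k)" if "k < d * d" for k
    by (rule instrument_seq_family[OF P[OF that] P'[OF that]])
  show ?thesis
    unfolding achievable_def power_add
  proof (intro exI conjI allI impI ballI)
    fix R assume "R \<in> S \<union> S'"
    then show "achieves R (2 ^ e * 2 ^ e') (K * K') ?P ?L \<epsilon>"
      by (rule UnE) (fact 1 2)+
  qed (fact 3)
qed

text \<open>Surplus pairs form a batch that serves no unitary.\<close>

lemma achievable_mono: "achievable S \<epsilon> e \<Longrightarrow> e \<le> e' \<Longrightarrow> achievable S \<epsilon> e'"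
  using achievable_Un[OF _ achievable_empty, of S \<epsilon> e "e' - e"] by simp

lemma achievable_finite:
  assumes "finite S" "\<And>R. R \<in> S \<Longrightarrow> \<exists>e. achievable {R} \<epsilon> e"
  shows "\<exists>e. achievable S \<epsilon> e"
  using assms
proof (induction S rule: finite_induct)
  case (insert R S)
  then obtain e e' where "achievable {R} \<epsilon> e" "achievable S \<epsilon> e'" by blast
  from achievable_Un[OF this] show ?case by auto
qed (use achievable_empty in blast)

text \<open>\<open>R\<close> is arbitrary in the induction because the corrections after a failed
  round are other unitaries. A round takes \<open>n + n\<close> pairs for the two teleportations,
  besides the batches for the finitely many corrections.\<close>

lemma achievable_unitary:
  assumes "d = 2 ^ n"
  shows "unitary_mat d R \<Longrightarrow> \<exists>e. achievable {R} ((1 - 1 / real (d * d)) ^ r) e"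
proof (induction r arbitrary: R)
  case 0
  have "achievable {R} 1 0"
    unfolding achievable_def
    by (intro exI[of _ "2 ^ 0"] exI[of _ "\<lambda>k. measure_op"]) (simp only: instrument_measure achieves_trivial simp_thms ball_simps)
  then show ?case by auto
next
  case (Suc r)
  let ?\<epsilon> = "(1 - 1 / real (d * d)) ^ r"
  let ?g = "\<lambda>l. R * mat_adjoint (\<sigma> l) * mat_adjoint R"
  have d: "0 < d * d" using assms by simp
  have "unitary_mat d (?g l)" if "l < d * d" for l
    by (intro unitary_mat_mult Suc.prems unitary_mat_adjoint unitary that)
  then have "\<exists>e. achievable {R'} ?\<epsilon> e" if "R' \<in> ?g ` {..<d * d}" for R'
    using Suc.IH that by blast
  then have "\<exists>e. achievable (?g ` {..<d * d}) ?\<epsilon> e"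
    by (rule achievable_finite[OF finite_imageI[OF finite_lessThan]])
  then obtain e K P L where P: "\<And>k. k < d * d \<Longrightarrow> instrument 1 1 (2 ^ e) K (P k)"
    and ach: "\<And>l. l < d * d \<Longrightarrow> achieves (?g l) (2 ^ e) K P L ?\<epsilon>"
    unfolding achievable_def by blast
  \<comment> \<open>Outcome 0 has no byproduct, hence nothing to correct.\<close>
  have g0: "?g 0 = 1\<^sub>m d"
    using Suc.prems by (simp add: zero unitary_mat_def right_mult_one_mat[of _ d d])
  \<comment> \<open>Discarding the batch yields \<open>2 ^ e\<close> outcomes, correcting yields
    \<open>L\<close>; both are padded to the maximum.\<close>
  let ?L = "max L (2 ^ e)"
  have "achieves (?g l) (2 ^ e) K P ?L (if l = 0 then 0 else ?\<epsilon>)" if "l < d * d" for l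
  proof (cases "l = 0")
    case True
    have "achieves (1\<^sub>m d) (2 ^ e) K P ?L 0"
      by (rule achieves_pad[OF achieves_one[OF P] max.cobounded2])
    then show ?thesis using True g0 by simp
  next
    case False
    then show ?thesis
      using achieves_pad[OF ach[OF that] max.cobounded1[of L "2 ^ e"]] by (simp only: if_False)
  qed
  moreover have "real (d * d) * (1 - (1 - 1 / real (d * d)) ^ Suc r) \<le> (\<Sum>l<d * d. 1 - (if l = 0 then 0 else ?\<epsilon>))"
  proof -
    \<comment> \<open>One outcome succeeds outright and the other \<open>d * d - 1\<close> fail with
      probability at most \<open>?\<epsilon>\<close>; the mean of these errors is
      \<open>(1 - 1 / real (d * d)) * ?\<epsilon>\<close>.\<close>
    have "(\<Sum>l<d * d. 1 - (if l = 0 then 0 else ?\<epsilon>)) = (\<Sum>l<d * d. (1 - ?\<epsilon>) + (if l = 0 then ?\<epsilon> else 0))"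
      by (intro sum.cong) auto
    also have "\<dots> = real (d * d) * (1 - ?\<epsilon>) + ?\<epsilon>"
      using d by (simp add: sum.distrib)
    also have "\<dots> = real (d * d) * (1 - (1 - 1 / real (d * d)) ^ Suc r)"
    proof -
      have "real (d * d) * (1 - (1 - 1 / real (d * d)) * y) = real (d * d) * (1 - y) + y" for y
        using d by (simp add: field_simps)
      then show ?thesis by simp
    qed
    finally show ?thesis by simp
  qed
  ultimately have "\<exists>K' P' L'. (\<forall>k<d * d. instrument 1 1 (d * d * 2 ^ e) K' (P' k)) \<and>
      achieves R (d * d * 2 ^ e) K' P' L' ((1 - 1 / real (d * d)) ^ Suc r)"
    by (intro achieves_step[OF Suc.prems P, where L = ?L and \<epsilon> = "\<lambda>l. if l = 0 then 0 else ?\<epsilon>"])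
  moreover have "d * d * 2 ^ e = 2 ^ (n + n + e)" using assms by (simp add: power_add)
  ultimately have "achievable {R} ((1 - 1 / real (d * d)) ^ Suc r) (n + n + e)"
    unfolding achievable_def by (simp only: ball_simps simp_thms Ball_def singleton_iff)
  then show ?case by blast
qed

end

subsection \<open>States\<close>

lemma cinner_add_left: "cinner (x + y) z = cinner x z + cinner (y::'e::complex_hilbert) z"
  by (metis cinner_add_right cinner_commute complex_cnj_add)

lemma cinner_zero: "cinner (x::'e::complex_hilbert) 0 = 0" "cinner 0 (x::'e) = 0"
  using cinner_add_right[of x 0 0] cinner_add_left[of 0 0 x] by simp_all

lemma cinner_scaleC_left: "cinner (a *\<^sub>C x) y = cnj a * cinner x (y::'e::complex_hilbert)"
  by (metis cinner_scaleC_right cinner_commute complex_cnj_mult)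

lemma cinner_sum_right: "cinner (x::'e::complex_hilbert) (\<Sum>i\<in>I. f i) = (\<Sum>i\<in>I. cinner x (f i))"
  by (induction I rule: infinite_finite_induct) (simp_all add: cinner_zero cinner_add_right)

lemma cinner_sum_left: "cinner (\<Sum>i\<in>I. f i) (x::'e::complex_hilbert) = (\<Sum>i\<in>I. cinner (f i) x)"
  by (induction I rule: infinite_finite_induct) (simp_all add: cinner_zero cinner_add_left)

lemma scaleC_zero: "a *\<^sub>C (0::'e::complex_hilbert) = 0" "0 *\<^sub>C (x::'e) = 0"
  using scaleC_add_right[of a "0::'e" 0] scaleC_add_left[of 0 0 x] by simp_all

lemma scaleC_sum_right: "a *\<^sub>C (\<Sum>i\<in>I. f i :: 'e::complex_hilbert) = (\<Sum>i\<in>I. a *\<^sub>C f i)"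
  by (induction I rule: infinite_finite_induct) (simp_all add: scaleC_zero scaleC_add_right)

lemma scaleC_sum_left: "(\<Sum>i\<in>I. f i) *\<^sub>C (x::'e::complex_hilbert) = (\<Sum>i\<in>I. f i *\<^sub>C x)"
  by (induction I rule: infinite_finite_induct) (simp_all add: scaleC_zero scaleC_add_left)

lemma state_norm_square: "complex_of_real ((state_norm \<psi>)\<^sup>2) = (\<Sum>i<dim_vec \<psi>. cinner (\<psi> $ i) (\<psi> $ i))"
  by (simp add: state_norm_def sum_nonneg cinner_self)

lemma state_norm_nonneg: "state_norm \<psi> \<ge> 0"
  by (simp add: state_norm_def sum_nonneg)

lemma state_norm_scaleR: "state_norm (map_vec ((*\<^sub>R) r) \<psi>) = \<bar>r\<bar> * state_norm \<psi>"
  by (simp add: state_norm_def power_mult_distrib sum_distrib_left[symmetric] real_sqrt_mult)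

section \<open>Operators acting on the finite-dimensional factor\<close>

lemma act_carrier: "T \<in> carrier_mat n m \<Longrightarrow> act T \<psi> \<in> carrier_vec n"
  by (simp add: act_def)

lemma act_index: "T \<in> carrier_mat n m \<Longrightarrow> i < n \<Longrightarrow> act T \<psi> $ i = (\<Sum>j<m. T $$ (i, j) *\<^sub>C \<psi> $ j)"
  by (auto simp: act_def)

lemma act_mult:
  assumes A: "A \<in> carrier_mat n m" and B: "B \<in> carrier_mat m l"
  shows "act (A * B) \<psi> = act A (act B \<psi>)"
proof (rule eq_vecI)
  have AB: "A * B \<in> carrier_mat n l" using assms by simp
  fix i assume "i < dim_vec (act A (act B \<psi>))"
  then have i: "i < n" using A by (simp add: act_def)
  have "act (A * B) \<psi> $ i = (\<Sum>j<l. \<Sum>k<m. A $$ (i, k) *\<^sub>C B $$ (k, j) *\<^sub>C \<psi> $ j)"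
    unfolding act_index[OF AB i]
    by (intro sum.cong refl)
      (simp add: mult_mat_index[OF A B i] scaleC_sum_left scaleC_scaleC del: index_mult_mat)
  also have "\<dots> = (\<Sum>k<m. \<Sum>j<l. A $$ (i, k) *\<^sub>C B $$ (k, j) *\<^sub>C \<psi> $ j)"
    by (rule sum.swap)
  also have "\<dots> = act A (act B \<psi>) $ i"
    unfolding act_index[OF A i]
    by (intro sum.cong refl) (simp add: act_index[OF B] scaleC_sum_right)
  finally show "act (A * B) \<psi> $ i = act A (act B \<psi>) $ i" .
qed (use assms in \<open>auto simp: act_def\<close>)

lemma act_scaleR: "act (complex_of_real r \<cdot>\<^sub>m T) \<psi> = map_vec ((*\<^sub>R) r) (act T \<psi>)"
proof (rule eq_vecI)
  fix i assume "i < dim_vec (map_vec ((*\<^sub>R) r) (act T \<psi>))"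
  then have i: "i < dim_row T" by (simp add: act_def)
  then show "act (complex_of_real r \<cdot>\<^sub>m T) \<psi> $ i = map_vec ((*\<^sub>R) r) (act T \<psi>) $ i"
    by (simp add: act_def scaleC_of_real[symmetric] scaleC_sum_right scaleC_scaleC)
qed (simp add: act_def)

lemma act_scaleR_vec:
  assumes T: "T \<in> carrier_mat n m" and \<psi>: "\<psi> \<in> carrier_vec m"
  shows "act T (map_vec ((*\<^sub>R) r) \<psi>) = map_vec ((*\<^sub>R) r) (act T \<psi>)"
proof (rule eq_vecI)
  fix i assume "i < dim_vec (map_vec ((*\<^sub>R) r) (act T \<psi>))"
  then have i: "i < n" using T by (simp add: act_def)
  then show "act T (map_vec ((*\<^sub>R) r) \<psi>) $ i = map_vec ((*\<^sub>R) r) (act T \<psi>) $ i"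
    using T \<psi> by (simp add: act_def scaleC_of_real[symmetric] scaleC_sum_right scaleC_scaleC mult.commute)
qed (simp add: act_def)

text \<open>Expanding the norms into inner products of the components brings out the completeness
  relation, which leaves the diagonal terms. A family of operators gives conservation of
  probability, a single one the isometry of a unitary.\<close>

lemma sum_state_norm_act:
  assumes T: "\<And>k. k \<in> I \<Longrightarrow> T k \<in> carrier_mat n m" and \<psi>: "\<psi> \<in> carrier_vec m"
    and iso: "\<And>s t. s < m \<Longrightarrow> t < m \<Longrightarrow> (\<Sum>k\<in>I. \<Sum>u<n. cnj (T k $$ (u, s)) * T k $$ (u, t)) = of_bool (s = t)"
  shows "(\<Sum>k\<in>I. (state_norm (act (T k) \<psi>))\<^sup>2) = (state_norm \<psi>)\<^sup>2"
proof -
  have "complex_of_real (\<Sum>k\<in>I. (state_norm (act (T k) \<psi>))\<^sup>2) =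
      (\<Sum>k\<in>I. \<Sum>u<n. \<Sum>t<m. \<Sum>s<m. cnj (T k $$ (u, s)) * T k $$ (u, t) * cinner (\<psi> $ s) (\<psi> $ t))"
    unfolding of_real_sum
  proof (rule sum.cong[OF refl])
    fix k assume k: "k \<in> I"
    have "complex_of_real ((state_norm (act (T k) \<psi>))\<^sup>2) = (\<Sum>u<n. cinner (act (T k) \<psi> $ u) (act (T k) \<psi> $ u))"
      unfolding state_norm_square using T[OF k] by (simp add: act_def)
    also have "\<dots> = (\<Sum>u<n. \<Sum>t<m. \<Sum>s<m. cnj (T k $$ (u, s)) * T k $$ (u, t) * cinner (\<psi> $ s) (\<psi> $ t))"
      by (intro sum.cong refl)
        (simp add: act_index[OF T[OF k]] cinner_sum_left cinner_sum_right cinner_scaleC_left cinner_scaleC_right mult_ac sum_distrib_left)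
    finally show "complex_of_real ((state_norm (act (T k) \<psi>))\<^sup>2) =
      (\<Sum>u<n. \<Sum>t<m. \<Sum>s<m. cnj (T k $$ (u, s)) * T k $$ (u, t) * cinner (\<psi> $ s) (\<psi> $ t))" .
  qed
  also have "\<dots> = (\<Sum>s<m. \<Sum>t<m. \<Sum>k\<in>I. \<Sum>u<n. cnj (T k $$ (u, s)) * T k $$ (u, t) * cinner (\<psi> $ s) (\<psi> $ t))"
    by (rule sum_swap4)
  also have "\<dots> = (\<Sum>s<m. \<Sum>t<m. (\<Sum>k\<in>I. \<Sum>u<n. cnj (T k $$ (u, s)) * T k $$ (u, t)) * cinner (\<psi> $ s) (\<psi> $ t))"
    by (simp only: sum_distrib_right)
  also have "\<dots> = (\<Sum>s<m. \<Sum>t<m. of_bool (s = t) * cinner (\<psi> $ s) (\<psi> $ t))"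
    by (intro sum.cong refl) (simp add: iso)
  also have "\<dots> = (\<Sum>s<m. cinner (\<psi> $ s) (\<psi> $ s))"
    by (intro sum.cong refl) (simp add: sum_of_bool_mult_lessThan)
  also have "\<dots> = complex_of_real ((state_norm \<psi>)\<^sup>2)"
    unfolding state_norm_square using \<psi> by simp
  finally show ?thesis by (simp only: of_real_eq_iff)
qed

lemma state_norm_act_unitary:
  assumes U: "unitary_mat n U" and \<psi>: "\<psi> \<in> carrier_vec n"
  shows "state_norm (act U \<psi>) = state_norm \<psi>"
proof -
  note cU = unitary_mat_carrier[OF U]
  have cU': "mat_adjoint U \<in> carrier_mat n n" using cU by simp
  have "(\<Sum>u<n. cnj (U $$ (u, s)) * U $$ (u, t)) = of_bool (s = t)" if "s < n" "t < n" for s t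
  proof -
    have "(\<Sum>u<n. cnj (U $$ (u, s)) * U $$ (u, t)) = (mat_adjoint U * U) $$ (s, t)"
      using that by (simp add: mult_mat_index[OF cU' cU] mat_adjoint_index[OF cU] del: index_mult_mat)
    then show ?thesis using U that by (simp add: unitary_mat_def)
  qed
  then have "(\<Sum>k\<in>{0::nat}. (state_norm (act U \<psi>))\<^sup>2) = (state_norm \<psi>)\<^sup>2"
    using cU \<psi> by (intro sum_state_norm_act[where T = "\<lambda>_. U"]) auto
  then show ?thesis
    using state_norm_nonneg[of \<psi>] state_norm_nonneg[of "act U \<psi>"] by (simp add: power2_eq_iff_nonneg)
qed

text \<open>A number below \<open>2 ^ m\<close> is determined by its first \<open>m\<close> bits, so
  \<open>m\<close> EPR pairs are one maximally entangled pair of dimension \<open>2 ^ m\<close>,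
  which may be factored into batches of any sizes.\<close>

lemma epr_pairs_eq:
  assumes "x < 2 ^ m" "y < 2 ^ m"
  shows "epr_pairs m x y = of_bool (x = y) * complex_of_real (1 / sqrt (2 ^ m))"
proof (cases "x = y")
  case True
  then show ?thesis
    by (simp add: epr_pairs_def epr_pair_def real_sqrt_power power_divide)
next
  case False
  have "\<exists>i<m. bit x i \<noteq> bit y i"
  proof (rule ccontr)
    assume *: "\<not> (\<exists>i<m. bit x i \<noteq> bit y i)"
    have "take_bit m x = take_bit m y"
      by (rule bit_eqI) (use * in \<open>auto simp: bit_take_bit_iff\<close>)
    with False show False using assms by (simp add: take_bit_nat_eq_self)
  qed
  then have "epr_pairs m x y = 0"
    unfolding epr_pairs_def epr_pair_def by (auto intro!: prod_zero)
  with False show ?thesis by simp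
qed

text \<open>The input index puts the register before the half, as \<open>with_epr_pairs\<close>
  does.\<close>

definition kraus_mat :: "nat \<Rightarrow> nat \<Rightarrow> (nat \<Rightarrow> nat \<Rightarrow> nat \<Rightarrow> complex) \<Rightarrow> complex mat" where
  "kraus_mat a D P = mat a (a * D) (\<lambda>(u, p). P (p mod D) u (p div D))"

lemma kraus_mat_carrier: "kraus_mat a D P \<in> carrier_mat a (a * D)"
  by (simp add: kraus_mat_def)

lemma kraus_mat_index_prod:
  "u < a \<Longrightarrow> s < a \<Longrightarrow> x < D \<Longrightarrow> kraus_mat a D P $$ (u, s * D + x) = P x u s"
  by (simp add: kraus_mat_def prod_index_less)

lemma kraus_mat_index: "u < a \<Longrightarrow> p < a * D \<Longrightarrow> kraus_mat a D P $$ (u, p) = P (p mod D) u (p div D)"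
  by (simp add: kraus_mat_def)

lemma local_operation_kraus_mat:
  assumes "instrument (2 ^ n) (2 ^ n) (2 ^ m) K P"
  shows "local_operation n m K (\<lambda>k. kraus_mat (2 ^ n) (2 ^ m) (P k))"
  unfolding local_operation_def
proof (intro conjI allI impI kraus_mat_carrier eq_matI)
  let ?a = "2 ^ n :: nat" and ?D = "2 ^ m :: nat"
  fix i j assume "i < dim_row (1\<^sub>m (?a * ?D) :: complex mat)" "j < dim_col (1\<^sub>m (?a * ?D) :: complex mat)"
  then have ij: "i < ?a * ?D" "j < ?a * ?D" by simp_all
  note i = div_mod_less[OF ij(1)] and j = div_mod_less[OF ij(2)]
  have adj: "mat_adjoint (kraus_mat ?a ?D (P k)) \<in> carrier_mat (?a * ?D) ?a" for k
    by (simp add: kraus_mat_carrier)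
  have "(\<Sum>k<K. (mat_adjoint (kraus_mat ?a ?D (P k)) * kraus_mat ?a ?D (P k)) $$ (i, j)) =
      (\<Sum>k<K. \<Sum>u<?a. cnj (P k (i mod ?D) u (i div ?D)) * P k (j mod ?D) u (j div ?D))"
    using ij by (simp add: mult_mat_index[OF adj kraus_mat_carrier ij] mat_adjoint_index[OF kraus_mat_carrier]
        kraus_mat_index del: index_mult_mat)
  also have "\<dots> = of_bool (i = j)"
    unfolding instrumentD[OF assms i(2) j(2) i(1) j(1)] using div_mod_eq_iff[of i ?D j] by auto
  finally show "mat (?a * ?D) (?a * ?D) (\<lambda>ij. \<Sum>k<K. (mat_adjoint (kraus_mat ?a ?D (P k)) * kraus_mat ?a ?D (P k)) $$ ij) $$ (i, j) =
      1\<^sub>m (?a * ?D) $$ (i, j)"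
    using ij by simp
qed simp_all

text \<open>Contracting both halves with the diagonal amplitudes of the pairs gives the sum over
  \<open>x\<close> in \<open>joint_op\<close>; the common value of these amplitudes is the
  normalisation postponed so far.\<close>

lemma raw_output_eq:
  "raw_output nA nB m (kraus_mat (2 ^ nA) (2 ^ m) P) (kraus_mat (2 ^ nB) (2 ^ m) Q) \<psi> =
    act (complex_of_real (1 / sqrt (2 ^ m)) \<cdot>\<^sub>m joint_op (2 ^ nA) (2 ^ nA) (2 ^ nB) (2 ^ nB) (2 ^ m) P Q) \<psi>"
proof (rule eq_vecI)
  let ?a = "2 ^ nA :: nat" and ?b = "2 ^ nB :: nat" and ?D = "2 ^ m :: nat"
  let ?P = "kraus_mat ?a ?D P" and ?Q = "kraus_mat ?b ?D Q"
  let ?w = "complex_of_real (1 / sqrt (2 ^ m))"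
  let ?J = "joint_op ?a ?a ?b ?b ?D P Q"
  have J: "?w \<cdot>\<^sub>m ?J \<in> carrier_mat (?a * ?b) (?a * ?b)" by simp
  note PQ = kron_carrier[OF kraus_mat_carrier[of ?a ?D P] kraus_mat_carrier[of ?b ?D Q]]
  fix i assume "i < dim_vec (act (?w \<cdot>\<^sub>m ?J) \<psi>)"
  then have i: "i < ?a * ?b" by (simp add: act_def joint_op_def)
  note i' = div_mod_less[OF i]
  have "raw_output nA nB m ?P ?Q \<psi> $ i = (\<Sum>p<?a * ?D. \<Sum>q<?b * ?D.
      (?P $$ (i div ?b, p) * ?Q $$ (i mod ?b, q)) *\<^sub>C
      (epr_pairs m (p mod ?D) (q mod ?D) *\<^sub>C \<psi> $ (p div ?D * ?b + q div ?D)))"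
    unfolding raw_output_def act_index[OF PQ i] sum_prod_index[of _ "?a * ?D" "?b * ?D"]
    by (intro sum.cong refl)
      (simp add: kron_index[OF kraus_mat_carrier kraus_mat_carrier] i prod_index_less with_epr_pairs_def)
  also have "\<dots> = (\<Sum>s<?a. \<Sum>x<?D. \<Sum>t<?b. \<Sum>y<?D.
      (of_bool (x = y) * (?w * (P x (i div ?b) s * Q y (i mod ?b) t))) *\<^sub>C \<psi> $ (s * ?b + t))"
    unfolding sum_prod_index[of _ ?a ?D] sum_prod_index[of _ ?b ?D]
    by (intro sum.cong refl)
      (simp add: kraus_mat_index_prod i' epr_pairs_eq scaleC_scaleC mult_ac)
  also have "\<dots> = (\<Sum>s<?a. \<Sum>x<?D. \<Sum>t<?b. (?w * (P x (i div ?b) s * Q x (i mod ?b) t)) *\<^sub>C \<psi> $ (s * ?b + t))"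
    unfolding scaleC_sum_left[symmetric]
    by (intro sum.cong refl) (simp only: sum_of_bool_mult_lessThan lessThan_iff if_True)
  also have "\<dots> = (\<Sum>s<?a. \<Sum>t<?b. \<Sum>x<?D. (?w * (P x (i div ?b) s * Q x (i mod ?b) t)) *\<^sub>C \<psi> $ (s * ?b + t))"
    by (rule sum.cong[OF refl], rule sum.swap)
  also have "\<dots> = (\<Sum>s<?a. \<Sum>t<?b. (?w \<cdot>\<^sub>m ?J) $$ (i, s * ?b + t) *\<^sub>C \<psi> $ (s * ?b + t))"
    unfolding scaleC_sum_left[symmetric] sum_distrib_left[symmetric]
    using i joint_op_carrier[of ?a ?a ?b ?b ?D P Q]
    by (intro sum.cong refl) (simp add: joint_op_index prod_index_less)
  also have "\<dots> = act (?w \<cdot>\<^sub>m ?J) \<psi> $ i"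
    unfolding act_index[OF J i] sum_prod_index ..
  finally show "raw_output nA nB m ?P ?Q \<psi> $ i = act (?w \<cdot>\<^sub>m ?J) \<psi> $ i" .
qed (simp add: raw_output_def act_def kron_def kraus_mat_def joint_op_def)

text \<open>For fixed \<open>x\<close> and \<open>y\<close> the sum over outcomes factors into the
  two local completeness relations, each of which forces \<open>x = y\<close>. The remaining count
  \<open>D\<close> is the squared norm of the unnormalised entangled state.\<close>

lemma joint_op_complete:
  assumes P: "instrument a a D K P" and Q: "instrument b b D L Q" and st: "s < a * b" "t < a * b"
  shows "(\<Sum>k<K. \<Sum>l<L. \<Sum>u<a * b. cnj (joint_op a a b b D (P k) (Q l) $$ (u, s)) * joint_op a a b b D (P k) (Q l) $$ (u, t))
    = of_nat D * of_bool (s = t)"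
proof -
  note s = div_mod_less[OF st(1)] and t = div_mod_less[OF st(2)]
  let ?A = "\<lambda>x y k u. cnj (P k x u (s div b)) * P k y u (t div b)"
  let ?B = "\<lambda>x y l v. cnj (Q l x v (s mod b)) * Q l y v (t mod b)"
  have J: "joint_op a a b b D (P k) (Q l) $$ (u * b + v, r) = (\<Sum>x<D. P k x u (r div b) * Q l x v (r mod b))"
    if "u < a" "v < b" "r < a * b" for k l u v r
    using that by (simp add: joint_op_index prod_index_less)
  have "(\<Sum>k<K. \<Sum>l<L. \<Sum>u<a * b. cnj (joint_op a a b b D (P k) (Q l) $$ (u, s)) * joint_op a a b b D (P k) (Q l) $$ (u, t))
      = (\<Sum>k<K. \<Sum>l<L. \<Sum>u<a. \<Sum>v<b. \<Sum>x<D. \<Sum>y<D. cnj (P k x u (s div b) * Q l x v (s mod b)) *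
          (P k y u (t div b) * Q l y v (t mod b)))"
    unfolding sum_prod_index
    by (intro sum.cong refl) (simp only: lessThan_iff J st cnj_sum sum_product)
  also have "\<dots> = (\<Sum>k<K. \<Sum>l<L. \<Sum>u<a. \<Sum>v<b. \<Sum>x<D. \<Sum>y<D. ?A x y k u * ?B x y l v)"
    by (simp add: mult_ac)
  also have "\<dots> = (\<Sum>k<K. \<Sum>u<a. \<Sum>l<L. \<Sum>v<b. \<Sum>x<D. \<Sum>y<D. ?A x y k u * ?B x y l v)"
    by (rule sum.cong[OF refl], rule sum.swap)
  also have "\<dots> = (\<Sum>k<K. \<Sum>u<a. \<Sum>y<D. \<Sum>x<D. \<Sum>l<L. \<Sum>v<b. ?A x y k u * ?B x y l v)"
    by (rule sum.cong[OF refl], rule sum.cong[OF refl], rule sum_swap4)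
  also have "\<dots> = (\<Sum>x<D. \<Sum>y<D. \<Sum>k<K. \<Sum>u<a. \<Sum>l<L. \<Sum>v<b. ?A x y k u * ?B x y l v)"
    by (rule sum_swap4)
  also have "\<dots> = (\<Sum>x<D. \<Sum>y<D. (\<Sum>k<K. \<Sum>u<a. ?A x y k u) * (\<Sum>l<L. \<Sum>v<b. ?B x y l v))"
    by (simp only: sum_distrib_left[symmetric] sum_distrib_right[symmetric])
  also have "\<dots> = (\<Sum>x<D. \<Sum>y<D. of_bool (y = x) * of_bool (s = t))"
    using div_mod_eq_iff[of s b t]
    by (intro sum.cong refl) (auto simp: instrumentD[OF P] instrumentD[OF Q] s t)
  also have "\<dots> = of_nat D * of_bool (s = t)"
    by (simp add: sum_of_bool_mult_lessThan)
  finally show ?thesis .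
qed

text \<open>Turns weights into probabilities: a corrected successful operator is a multiple of
  \<open>U\<close>, so its outcome has probability \<open>(c k l)\<^sup>2 / 2 ^ m\<close> for every
  state, and all outcomes together have probability 1. The factor \<open>c k l\<close> is real and
  nonnegative so that normalising leaves exactly \<open>act U \<psi>\<close>, without a
  phase.\<close>

lemma instantaneous_protocol:
  fixes P Q :: "nat \<Rightarrow> nat \<Rightarrow> nat \<Rightarrow> nat \<Rightarrow> complex" and c :: "nat \<Rightarrow> nat \<Rightarrow> real"
  assumes U: "unitary_mat (2 ^ nA * 2 ^ nB) U"
    and P: "instrument (2 ^ nA) (2 ^ nA) (2 ^ m) K P" and Q: "instrument (2 ^ nB) (2 ^ nB) (2 ^ m) L Q"
    and c: "\<And>k l. k < K \<Longrightarrow> l < L \<Longrightarrow> c k l \<ge> 0"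
    and corr: "\<And>k l. k < K \<Longrightarrow> l < L \<Longrightarrow> c k l \<noteq> 0 \<Longrightarrow> \<exists>VA VB. qubitwise_unitary nA VA \<and> qubitwise_unitary nB VB \<and>
      kron VA VB * joint_op (2 ^ nA) (2 ^ nA) (2 ^ nB) (2 ^ nB) (2 ^ m) (P k) (Q l) = complex_of_real (c k l) \<cdot>\<^sub>m U"
    and bound: "2 ^ m * (1 - \<epsilon>) \<le> (\<Sum>k<K. \<Sum>l<L. (c k l)\<^sup>2)"
  shows "\<exists>K L (M :: nat \<Rightarrow> complex mat) (N :: nat \<Rightarrow> complex mat)
      (VA :: nat \<Rightarrow> nat \<Rightarrow> complex mat) (VB :: nat \<Rightarrow> nat \<Rightarrow> complex mat).
    local_operation nA m K M \<and> local_operation nB m L N \<and>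
    (\<forall>k<K. \<forall>l<L. qubitwise_unitary nA (VA k l) \<and> qubitwise_unitary nB (VB k l)) \<and>
    (\<forall>\<psi> :: 'e::complex_hilbert vec. is_state (2 ^ nA * 2 ^ nB) \<psi> \<longrightarrow>
      (\<Sum>(k, l) \<in> {(k, l). k < K \<and> l < L \<and>
           act U \<psi> \<noteq> act (kron (VA k l) (VB k l)) (output_state nA nB m (M k) (N l) \<psi>)}.
         output_prob nA nB m (M k) (N l) \<psi>) \<le> \<epsilon>)"
proof -
  let ?a = "2 ^ nA :: nat" and ?b = "2 ^ nB :: nat" and ?D = "2 ^ m :: nat"
  let ?J = "\<lambda>k l. joint_op ?a ?a ?b ?b ?D (P k) (Q l)"
  let ?r = "1 / sqrt (2 ^ m)"
  define W where "W = (\<lambda>k l. complex_of_real ?r \<cdot>\<^sub>m ?J k l)"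
  have W: "W k l \<in> carrier_mat (?a * ?b) (?a * ?b)" for k l
    by (simp add: W_def)
  have "\<forall>k l. \<exists>V. k < K \<longrightarrow> l < L \<longrightarrow> qubitwise_unitary nA (fst V) \<and> qubitwise_unitary nB (snd V) \<and>
      (c k l \<noteq> 0 \<longrightarrow> kron (fst V) (snd V) * ?J k l = complex_of_real (c k l) \<cdot>\<^sub>m U)"
  proof (intro allI)
    fix k l
    show "\<exists>V. k < K \<longrightarrow> l < L \<longrightarrow> qubitwise_unitary nA (fst V) \<and> qubitwise_unitary nB (snd V) \<and>
      (c k l \<noteq> 0 \<longrightarrow> kron (fst V) (snd V) * ?J k l = complex_of_real (c k l) \<cdot>\<^sub>m U)"
    proof (cases "k < K \<and> l < L \<and> c k l \<noteq> 0")
      case True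
      then show ?thesis using corr[of k l] by (metis fst_conv snd_conv)
    next
      case False
      \<comment> \<open>Where no success is claimed any correction will do; the identities are the
        default.\<close>
      then show ?thesis
        by (intro exI[of _ "(1\<^sub>m ?a, 1\<^sub>m ?b)"]) (auto simp: qubitwise_unitary_one)
    qed
  qed
  then obtain V where V: "\<And>k l. k < K \<Longrightarrow> l < L \<Longrightarrow> qubitwise_unitary nA (fst (V k l)) \<and> qubitwise_unitary nB (snd (V k l)) \<and>
      (c k l \<noteq> 0 \<longrightarrow> kron (fst (V k l)) (snd (V k l)) * ?J k l = complex_of_real (c k l) \<cdot>\<^sub>m U)"
    by metis
  define VA where "VA = (\<lambda>k l. fst (V k l))"
  define VB where "VB = (\<lambda>k l. snd (V k l))"
  let ?M = "\<lambda>k. kraus_mat ?a ?D (P k)" and ?N = "\<lambda>l. kraus_mat ?b ?D (Q l)"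
  have raw: "raw_output nA nB m (?M k) (?N l) \<psi> = act (W k l) \<psi>" for k l and \<psi> :: "'e vec"
    unfolding W_def by (rule raw_output_eq)
  have good: "act U \<psi> = act (kron (VA k l) (VB k l)) (output_state nA nB m (?M k) (?N l) \<psi>) \<and>
      output_prob nA nB m (?M k) (?N l) \<psi> = (c k l)\<^sup>2 / 2 ^ m"
    if \<psi>: "is_state (?a * ?b) \<psi>" and kl: "k < K" "l < L" and nz: "c k l \<noteq> 0" for k l and \<psi> :: "'e vec"
  proof -
    have \<psi>': "\<psi> \<in> carrier_vec (?a * ?b)" "state_norm \<psi> = 1"
      using \<psi> by (simp_all add: is_state_def)
    let ?V = "kron (VA k l) (VB k l)"
    have uV: "unitary_mat (?a * ?b) ?V"
      using V[OF kl] unfolding VA_def VB_def by (intro unitary_mat_kron qubitwise_unitary_unitary) auto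
    note cV = unitary_mat_carrier[OF uV]
    have "?V * W k l = complex_of_real ?r \<cdot>\<^sub>m (?V * ?J k l)"
      unfolding W_def by (rule mult_smult_distrib[OF cV joint_op_carrier])
    also have "\<dots> = complex_of_real (?r * c k l) \<cdot>\<^sub>m U"
      using V[OF kl] nz by (simp add: VA_def VB_def smult_smult_mat_assoc)
    finally have VW: "act ?V (act (W k l) \<psi>) = map_vec ((*\<^sub>R) (?r * c k l)) (act U \<psi>)"
      unfolding act_mult[OF cV W, symmetric] by (simp only: act_scaleR)
    have pos: "?r * c k l > 0"
      using c[OF kl] nz by simp
    \<comment> \<open>The unitary correction preserves the norm, so the probability can be read off
      after it.\<close>
    have "state_norm (act (W k l) \<psi>) = state_norm (act ?V (act (W k l) \<psi>))"
      by (rule state_norm_act_unitary[OF uV act_carrier[OF W], symmetric])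
    also have "\<dots> = ?r * c k l"
      unfolding VW state_norm_scaleR state_norm_act_unitary[OF U \<psi>'(1)] by (simp only: \<psi>'(2) mult_1_right abs_of_pos[OF pos])
    finally have n: "state_norm (act (W k l) \<psi>) = ?r * c k l" .
    have "act ?V (output_state nA nB m (?M k) (?N l) \<psi>) =
        map_vec ((*\<^sub>R) (1 / (?r * c k l))) (map_vec ((*\<^sub>R) (?r * c k l)) (act U \<psi>))"
      unfolding output_state_def raw n act_scaleR_vec[OF cV act_carrier[OF W]] VW ..
    also have "\<dots> = act U \<psi>"
      using pos by (intro eq_vecI) (auto simp: act_def)
    finally have "act ?V (output_state nA nB m (?M k) (?N l) \<psi>) = act U \<psi>" .
    moreover have "output_prob nA nB m (?M k) (?N l) \<psi> = (c k l)\<^sup>2 / 2 ^ m"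
      unfolding output_prob_def raw n by (simp add: power_mult_distrib power_divide)
    ultimately show ?thesis by simp
  qed
  have total: "(\<Sum>k<K. \<Sum>l<L. output_prob nA nB m (?M k) (?N l) \<psi>) = 1"
    if \<psi>: "is_state (?a * ?b) \<psi>" for \<psi> :: "'e vec"
  proof -
    have "(\<Sum>k<K. \<Sum>l<L. output_prob nA nB m (?M k) (?N l) \<psi>) =
        (\<Sum>z\<in>{..<K} \<times> {..<L}. (state_norm (act ((\<lambda>(k, l). W k l) z) \<psi>))\<^sup>2)"
      unfolding sum.cartesian_product output_prob_def raw by (rule sum.cong) auto
    also have "\<dots> = (state_norm \<psi>)\<^sup>2"
    proof (rule sum_state_norm_act)
      show "\<psi> \<in> carrier_vec (?a * ?b)" using \<psi> by (simp add: is_state_def)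
      show "(\<lambda>(k, l). W k l) z \<in> carrier_mat (?a * ?b) (?a * ?b)" for z
        using W by (cases z) simp
      fix s t assume st: "s < ?a * ?b" "t < ?a * ?b"
      have rr: "complex_of_real ?r * complex_of_real ?r = 1 / of_nat ?D"
        by (simp add: of_real_mult[symmetric] del: of_real_mult)
      have "(\<Sum>z\<in>{..<K} \<times> {..<L}. \<Sum>u<?a * ?b. cnj ((\<lambda>(k, l). W k l) z $$ (u, s)) * (\<lambda>(k, l). W k l) z $$ (u, t)) =
        (\<Sum>k<K. \<Sum>l<L. \<Sum>u<?a * ?b. cnj (W k l $$ (u, s)) * W k l $$ (u, t))"
        by (rule trans[OF sum.cong[OF refl] sum.cartesian_product[symmetric]]) auto
      also have "\<dots> = (\<Sum>k<K. \<Sum>l<L. \<Sum>u<?a * ?b. (complex_of_real ?r * complex_of_real ?r) * (cnj (?J k l $$ (u, s)) * ?J k l $$ (u, t)))"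
        using st by (intro sum.cong refl) (simp add: W_def joint_op_def)
      also have "\<dots> = (complex_of_real ?r * complex_of_real ?r) * (of_nat ?D * of_bool (s = t))"
        unfolding joint_op_complete[OF P Q st, symmetric] by (simp only: sum_distrib_left)
      also have "\<dots> = of_bool (s = t)" unfolding rr by simp
      finally show "(\<Sum>z\<in>{..<K} \<times> {..<L}. \<Sum>u<?a * ?b. cnj ((\<lambda>(k, l). W k l) z $$ (u, s)) * (\<lambda>(k, l). W k l) z $$ (u, t)) = of_bool (s = t)" .
    qed
    also have "\<dots> = 1" using \<psi> by (simp add: is_state_def)
    finally show ?thesis .
  qed
  have fail: "(\<Sum>(k, l) \<in> {(k, l). k < K \<and> l < L \<and>
           act U \<psi> \<noteq> act (kron (VA k l) (VB k l)) (output_state nA nB m (?M k) (?N l) \<psi>)}.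
         output_prob nA nB m (?M k) (?N l) \<psi>) \<le> \<epsilon>"
    if \<psi>: "is_state (?a * ?b) \<psi>" for \<psi> :: "'e vec"
  proof -
    let ?bad = "{(k, l). k < K \<and> l < L \<and>
           act U \<psi> \<noteq> act (kron (VA k l) (VB k l)) (output_state nA nB m (?M k) (?N l) \<psi>)}"
    let ?p = "\<lambda>(k, l). output_prob nA nB m (?M k) (?N l) \<psi>"
    \<comment> \<open>On bad outcomes \<open>c k l\<close> is 0, so its weight may be subtracted.
      Elsewhere the difference is nonnegative (it is 0 if \<open>c k l\<close> is not), so the sum
      may be extended to all outcomes.\<close>
    have "sum ?p ?bad \<le> (\<Sum>z\<in>{..<K} \<times> {..<L}. ?p z - (\<lambda>(k, l). (c k l)\<^sup>2 / 2 ^ m) z)"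
    proof -
      have "sum ?p ?bad = (\<Sum>z\<in>?bad. ?p z - (\<lambda>(k, l). (c k l)\<^sup>2 / 2 ^ m) z)"
      proof (rule sum.cong[OF refl], clarify)
        fix k l assume kl: "k < K" "l < L" and ne: "act U \<psi> \<noteq> act (kron (VA k l) (VB k l)) (output_state nA nB m (?M k) (?N l) \<psi>)"
        then have "c k l = 0" using good[OF \<psi> kl] by blast
        then show "output_prob nA nB m (?M k) (?N l) \<psi> = output_prob nA nB m (?M k) (?N l) \<psi> - (c k l)\<^sup>2 / 2 ^ m"
          by simp
      qed
      also have "\<dots> \<le> (\<Sum>z\<in>{..<K} \<times> {..<L}. ?p z - (\<lambda>(k, l). (c k l)\<^sup>2 / 2 ^ m) z)"
      proof (rule sum_mono2)
        fix z assume z: "z \<in> {..<K} \<times> {..<L} - ?bad"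
        then obtain k l where [simp]: "z = (k, l)" and kl: "k < K" "l < L" by auto
        have "0 \<le> output_prob nA nB m (?M k) (?N l) \<psi>" by (simp add: output_prob_def)
        then show "0 \<le> ?p z - (\<lambda>(k, l). (c k l)\<^sup>2 / 2 ^ m) z"
          using good[OF \<psi> kl] by (cases "c k l = 0") simp_all
      qed auto
      finally show ?thesis .
    qed
    also have "\<dots> = (\<Sum>k<K. \<Sum>l<L. output_prob nA nB m (?M k) (?N l) \<psi>) - (\<Sum>k<K. \<Sum>l<L. (c k l)\<^sup>2) / 2 ^ m"
      unfolding sum_subtractf sum.cartesian_product[symmetric] sum_divide_distrib by simp
    also have "\<dots> \<le> \<epsilon>"
    proof -
      have "1 - \<epsilon> \<le> (\<Sum>k<K. \<Sum>l<L. (c k l)\<^sup>2) / 2 ^ m"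
        using bound by (simp add: field_simps)
      then show ?thesis unfolding total[OF \<psi>] by linarith
    qed
    finally show ?thesis .
  qed
  show ?thesis
  proof (intro exI conjI allI impI)
    show "local_operation nA m K ?M" by (rule local_operation_kraus_mat[OF P])
    show "local_operation nB m L ?N" by (rule local_operation_kraus_mat[OF Q])
    show "qubitwise_unitary nA (VA k l)" "qubitwise_unitary nB (VB k l)" if "k < K" "l < L" for k l
      using V[OF that] by (simp_all add: VA_def VB_def)
  qed (rule fail)
qed

text \<open>The phase of \<open>z\<close> is absorbed into one of the qubits, so there must be at least one.\<close>

lemma qubitwise_unitary_correction:
  assumes X: "qubitwise_unitary nA X" and Y: "qubitwise_unitary nB Y" and z: "z \<noteq> 0" and n: "nA + nB > 0"
    and U: "U \<in> carrier_mat (2 ^ nA * 2 ^ nB) (2 ^ nA * 2 ^ nB)"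
  shows "\<exists>VA VB. qubitwise_unitary nA VA \<and> qubitwise_unitary nB VB \<and>
    kron VA VB * (z \<cdot>\<^sub>m (kron X Y * U)) = complex_of_real (norm z) \<cdot>\<^sub>m U"
proof -
  let ?d = "2 ^ nA * 2 ^ nB :: nat"
  \<comment> \<open>The inverse of the phase of \<open>z\<close>, so that \<open>z * ?w\<close> is
    the real number \<open>norm z\<close>.\<close>
  let ?w = "cnj (sgn z)"
  have w: "norm ?w = 1" using z by (simp add: norm_sgn)
  have "z * ?w = z * cnj z / complex_of_real (norm z)"
    by (simp add: sgn_eq)
  also have "\<dots> = complex_of_real (norm z)"
    using z by (simp only: complex_norm_square[symmetric]) (simp add: power2_eq_square)
  finally have wz: "z * ?w = complex_of_real (norm z)" .
  note uX = qubitwise_unitary_unitary[OF X] and uY = qubitwise_unitary_unitary[OF Y]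
  have uXY: "unitary_mat ?d (kron X Y)" by (rule unitary_mat_kron[OF uX uY])
  note cXY = unitary_mat_carrier[OF uXY]
  have c': "mat_adjoint (kron X Y) \<in> carrier_mat ?d ?d" using cXY by simp
  have "\<exists>VA VB. qubitwise_unitary nA VA \<and> qubitwise_unitary nB VB \<and> kron VA VB = ?w \<cdot>\<^sub>m mat_adjoint (kron X Y)"
  proof (cases "nA > 0")
    case True
    have "kron (?w \<cdot>\<^sub>m mat_adjoint X) (mat_adjoint Y) = ?w \<cdot>\<^sub>m mat_adjoint (kron X Y)"
      by (simp only: kron_smult_left kron_adjoint)
    then show ?thesis
      using qubitwise_unitary_smult[OF qubitwise_unitary_adjoint[OF X] w True] qubitwise_unitary_adjoint[OF Y] by blast
  next
    case False
    then have "nB > 0" using n by simp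
    have "kron (mat_adjoint X) (?w \<cdot>\<^sub>m mat_adjoint Y) = ?w \<cdot>\<^sub>m mat_adjoint (kron X Y)"
      by (simp only: kron_smult_right kron_adjoint)
    then show ?thesis
      using qubitwise_unitary_smult[OF qubitwise_unitary_adjoint[OF Y] w \<open>nB > 0\<close>] qubitwise_unitary_adjoint[OF X] by blast
  qed
  then obtain VA VB where V: "qubitwise_unitary nA VA" "qubitwise_unitary nB VB" "kron VA VB = ?w \<cdot>\<^sub>m mat_adjoint (kron X Y)"
    by blast
  have XYU: "kron X Y * U \<in> carrier_mat ?d ?d" using cXY U by (rule mult_carrier_mat)
  have "kron VA VB * (z \<cdot>\<^sub>m (kron X Y * U)) = z \<cdot>\<^sub>m (?w \<cdot>\<^sub>m (mat_adjoint (kron X Y) * (kron X Y * U)))"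
    unfolding V(3) using mult_smult_distrib[OF smult_carrier_mat[OF c'] XYU] mult_smult_assoc_mat[OF c' XYU] by simp
  also have "\<dots> = complex_of_real (norm z) \<cdot>\<^sub>m U"
    unfolding unitary_mat_cancel[OF uXY U] smult_smult_mat_assoc wz ..
  finally show ?thesis using V by blast
qed

subsection \<open>Moving Alice's register to Bob and back\<close>

text \<open>Alice's \<open>send_op\<close> is the Bell measurement of a teleportation, which Bob's \<open>append_op\<close>
completes by placing his halves before his register. In the opposite direction, Bob measures the first
factor of his register with \<open>send_first_op\<close>, and Alice's \<open>output_op\<close> makes her halves the output.\<close>

definition send_op :: "nat \<Rightarrow> complex mat \<Rightarrow> nat \<Rightarrow> nat \<Rightarrow> nat \<Rightarrow> complex" where
  "send_op a T = (\<lambda>x u s. complex_of_real (1 / sqrt a) * T $$ (x, s))"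

definition append_op :: "nat \<Rightarrow> nat \<Rightarrow> nat \<Rightarrow> nat \<Rightarrow> complex" where
  "append_op b = (\<lambda>x u s. of_bool (u = x * b + s))"

definition output_op :: "nat \<Rightarrow> nat \<Rightarrow> nat \<Rightarrow> complex" where
  "output_op = (\<lambda>x u s. of_bool (u = x))"

definition send_first_op :: "nat \<Rightarrow> nat \<Rightarrow> complex mat \<Rightarrow> nat \<Rightarrow> nat \<Rightarrow> nat \<Rightarrow> complex" where
  "send_first_op a b T = (\<lambda>x u s. complex_of_real (1 / sqrt a) * T $$ (x, s div b) * of_bool (u = s mod b))"

lemma instrument_append: "instrument b (a * b) a 1 (\<lambda>_. append_op b)"
  unfolding instrument_def
proof (intro allI impI)
  fix x y s t assume xy: "x < a" "y < a" and st: "s < b" "t < b"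
  have "(\<Sum>k<1::nat. \<Sum>u<a * b. cnj (append_op b x u s) * append_op b y u t) =
      (\<Sum>u<a * b. of_bool (u = x * b + s) * of_bool (u = y * b + t))"
    by (auto simp: append_op_def of_bool_def intro!: sum.cong)
  also have "\<dots> = of_bool (x * b + s = y * b + t)"
    by (simp only: sum_of_bool_mult_lessThan prod_index_less[OF xy(1) st(1)] if_True)
  also have "\<dots> = of_bool (x = y \<and> s = t)"
    using st div_mod_eq_iff[of "x * b + s" b "y * b + t"] by simp
  finally show "(\<Sum>k<1::nat. \<Sum>u<a * b. cnj (append_op b x u s) * append_op b y u t) = of_bool (x = y \<and> s = t)" .
qed

lemma instrument_output: "instrument 1 a a 1 (\<lambda>_. output_op)"
  by (simp add: instrument_def output_op_def sum_of_bool_mult_lessThan)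

context error_basis
begin

lemma instrument_send: "instrument d 1 d (d * d) (\<lambda>k. send_op d (\<sigma> k))"
  unfolding instrument_def
proof (intro allI impI)
  fix x y s t assume xy: "x < d" "y < d" and st: "s < d" "t < d"
  have "(\<Sum>k<d * d. \<Sum>u<1::nat. cnj (send_op d (\<sigma> k) x u s) * send_op d (\<sigma> k) y u t) =
      (complex_of_real (1 / sqrt d) * complex_of_real (1 / sqrt d)) *
      (\<Sum>k<d * d. cnj (\<sigma> k $$ (x, s)) * \<sigma> k $$ (y, t))"
    unfolding sum_distrib_left by (intro sum.cong refl) (simp add: send_op_def mult_ac)
  also have "\<dots> = of_bool (x = y \<and> s = t)"
    unfolding sqrt_mult_self complete[OF xy(1) st(1) xy(2) st(2)] using xy by simp
  finally show "(\<Sum>k<d * d. \<Sum>u<1::nat. cnj (send_op d (\<sigma> k) x u s) * send_op d (\<sigma> k) y u t) = of_bool (x = y \<and> s = t)" .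
qed

lemma instrument_send_first: "instrument (d * b) b d (d * d) (\<lambda>k. send_first_op d b (\<sigma> k))"
  unfolding instrument_def
proof (intro allI impI)
  fix x y s t assume xy: "x < d" "y < d" and st: "s < d * b" "t < d * b"
  note s = div_mod_less[OF st(1)] and t = div_mod_less[OF st(2)]
  have "(\<Sum>k<d * d. \<Sum>u<b. cnj (send_first_op d b (\<sigma> k) x u s) * send_first_op d b (\<sigma> k) y u t) =
      (\<Sum>k<d * d. (complex_of_real (1 / sqrt d) * complex_of_real (1 / sqrt d)) *
        (cnj (\<sigma> k $$ (x, s div b)) * \<sigma> k $$ (y, t div b)) *
        (\<Sum>u<b. of_bool (u = s mod b) * of_bool (u = t mod b)))"
    unfolding sum_distrib_left by (intro sum.cong refl) (simp add: send_first_op_def mult_ac)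
  also have "\<dots> = (complex_of_real (1 / sqrt d) * complex_of_real (1 / sqrt d)) * of_bool (s mod b = t mod b) *
      (\<Sum>k<d * d. cnj (\<sigma> k $$ (x, s div b)) * \<sigma> k $$ (y, t div b))"
    using s t by (simp only: sum_of_bool_mult_lessThan if_True sum_distrib_left mult_ac)
  also have "\<dots> = of_bool (s mod b = t mod b) * of_bool (x = y \<and> s div b = t div b)"
    unfolding sqrt_mult_self complete[OF xy(1) s(1) xy(2) t(1)] using xy by simp
  also have "\<dots> = of_bool (x = y \<and> s = t)"
    using div_mod_eq_iff[of s b t] by auto
  finally show "(\<Sum>k<d * d. \<Sum>u<b. cnj (send_first_op d b (\<sigma> k) x u s) * send_first_op d b (\<sigma> k) y u t) = of_bool (x = y \<and> s = t)" .
qed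

end

text \<open>A teleportation with byproduct \<open>T\<close>: the half that Bob puts in front of his
  register takes over the state of \<open>A\<close>. The factor is that of the Bell
  measurement.\<close>

lemma joint_op_send:
  assumes T: "T \<in> carrier_mat a a"
  shows "joint_op a 1 b (a * b) a (send_op a T) (append_op b) = complex_of_real (1 / sqrt a) \<cdot>\<^sub>m kron T (1\<^sub>m b)"
proof (rule eq_matI)
  note k = kron_carrier[OF T one_carrier_mat[of b]]
  fix v s assume "v < dim_row (complex_of_real (1 / sqrt a) \<cdot>\<^sub>m kron T (1\<^sub>m b))"
    "s < dim_col (complex_of_real (1 / sqrt a) \<cdot>\<^sub>m kron T (1\<^sub>m b))"
  then have vs: "v < a * b" "s < a * b" using k by auto
  note v = div_mod_less[OF vs(1)] and s = div_mod_less[OF vs(2)]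
  have "v = x * b + s mod b \<longleftrightarrow> x = v div b \<and> v mod b = s mod b" for x
    using s(2) div_mod_eq_iff[of v b "x * b + s mod b"] by auto
  then have "joint_op a 1 b (a * b) a (send_op a T) (append_op b) $$ (v, s) =
      (\<Sum>x<a. of_bool (x = v div b) * (of_bool (v mod b = s mod b) * (complex_of_real (1 / sqrt a) * T $$ (x, s div b))))"
    using vs by (simp add: joint_op_index send_op_def append_op_def of_bool_conj mult_ac)
  also have "\<dots> = complex_of_real (1 / sqrt a) * (T $$ (v div b, s div b) * of_bool (v mod b = s mod b))"
    by (simp only: sum_of_bool_mult_lessThan v if_True) (simp only: mult_ac)
  also have "\<dots> = (complex_of_real (1 / sqrt a) \<cdot>\<^sub>m kron T (1\<^sub>m b)) $$ (v, s)"
    using vs v s k by (simp add: kron_index[OF T one_carrier_mat])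
  finally show "joint_op a 1 b (a * b) a (send_op a T) (append_op b) $$ (v, s) =
    (complex_of_real (1 / sqrt a) \<cdot>\<^sub>m kron T (1\<^sub>m b)) $$ (v, s)" .
qed (use T in \<open>auto simp: kron_def\<close>)

text \<open>The way back. Since the index of the first factor is the same whether Alice or Bob holds
  it, the matrix equals that of \<open>joint_op_send\<close>.\<close>

lemma joint_op_send_first:
  assumes T: "T \<in> carrier_mat a a"
  shows "joint_op 1 a (a * b) b a output_op (send_first_op a b T) = complex_of_real (1 / sqrt a) \<cdot>\<^sub>m kron T (1\<^sub>m b)"
proof (rule eq_matI)
  note k = kron_carrier[OF T one_carrier_mat[of b]]
  fix v s assume "v < dim_row (complex_of_real (1 / sqrt a) \<cdot>\<^sub>m kron T (1\<^sub>m b))"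
    "s < dim_col (complex_of_real (1 / sqrt a) \<cdot>\<^sub>m kron T (1\<^sub>m b))"
  then have vs: "v < a * b" "s < a * b" using k by auto
  note v = div_mod_less[OF vs(1)] and s = div_mod_less[OF vs(2)]
  have "joint_op 1 a (a * b) b a output_op (send_first_op a b T) $$ (v, s) =
      (\<Sum>x<a. of_bool (v div b = x) * (of_bool (v mod b = s mod b) * (complex_of_real (1 / sqrt a) * T $$ (x, s div b))))"
    using vs by (simp add: joint_op_index send_first_op_def output_op_def mult_ac)
  also have "\<dots> = complex_of_real (1 / sqrt a) * (T $$ (v div b, s div b) * of_bool (v mod b = s mod b))"
    by (simp only: sum_of_bool_mult_lessThan v if_True) (simp only: mult_ac)
  also have "\<dots> = (complex_of_real (1 / sqrt a) \<cdot>\<^sub>m kron T (1\<^sub>m b)) $$ (v, s)"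
    using vs v s k by (simp add: kron_index[OF T one_carrier_mat])
  finally show "joint_op 1 a (a * b) b a output_op (send_first_op a b T) $$ (v, s) =
    (complex_of_real (1 / sqrt a) \<cdot>\<^sub>m kron T (1\<^sub>m b)) $$ (v, s)" .
qed (use T in \<open>auto simp: kron_def\<close>)

text \<open>The Pauli left on \<open>A\<close> is a product, of Bob's final byproduct
  \<open>\<tau> g\<close> and the \<open>A\<close> part \<open>\<tau> f\<close> of the key after
  \<open>U\<close>. It need not be reduced to one basis element, since qubit-wise unitaries are
  closed under products.\<close>

lemma bipartite_protocol:
  fixes a b :: nat and \<tau> \<upsilon> :: "nat \<Rightarrow> complex mat"
  defines "\<sigma> \<equiv> (\<lambda>k. kron (\<tau> (k div (b * b))) (\<upsilon> (k mod (b * b))))"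
  assumes \<tau>: "error_basis a \<tau>" and \<upsilon>: "error_basis b \<upsilon>" and pos: "a > 0" "b > 0"
    and U: "U \<in> carrier_mat (a * b) (a * b)"
    and P: "\<And>k. k < a * b * (a * b) \<Longrightarrow> instrument 1 1 D K (P k)"
    and ach: "error_basis.achieves (a * b) \<sigma> U D K P L \<epsilon>"
  shows "\<exists>K L M N c. instrument a a (a * D * a) K M \<and> instrument b b (a * D * a) L N \<and>
    (\<forall>k<K. \<forall>l<L. c k l = 0 \<or> (\<exists>g f f'. g < a * a \<and> f < a * a \<and> f' < b * b \<and>
      joint_op a a b b (a * D * a) (M k) (N l) = c k l \<cdot>\<^sub>m (kron (\<tau> g * \<tau> f) (\<upsilon> f') * U))) \<and>
    real (a * D * a) * (1 - \<epsilon>) \<le> (\<Sum>k<K. \<Sum>l<L. (norm (c k l))\<^sup>2)"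
proof -
  interpret t: error_basis a \<tau> by fact
  interpret u: error_basis b \<upsilon> by fact
  interpret s: error_basis "a * b" \<sigma> unfolding \<sigma>_def by (rule error_basis_kron[OF \<tau> \<upsilon>])
  let ?d = "a * b"
  obtain Q c where Q: "instrument ?d ?d D L Q"
    and h: "\<And>k \<alpha> \<beta>. k < ?d * ?d \<Longrightarrow> \<alpha> < K \<Longrightarrow> \<beta> < L \<Longrightarrow> s.heralds U (c k \<alpha> \<beta>) (s.collapse D (P k \<alpha>) (Q \<beta>) * \<sigma> k)"
    and bd: "\<And>k. k < ?d * ?d \<Longrightarrow> real D * (1 - \<epsilon>) \<le> (\<Sum>\<alpha><K. \<Sum>\<beta><L. (norm (c k \<alpha> \<beta>))\<^sup>2)"
    using ach unfolding s.achieves_def by blast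
  \<comment> \<open>\<open>B\<close> has not moved, so the key after the first teleportation is
    \<open>\<tau> g\<close> on \<open>A\<close> and the identity on \<open>B\<close>; in the basis
    of the whole system its index is \<open>g * (b * b)\<close>.\<close>
  define \<kappa> where "\<kappa> = (\<lambda>g. g * (b * b))"
  have \<kappa>: "\<kappa> g < ?d * ?d" "\<sigma> (\<kappa> g) = kron (\<tau> g) (1\<^sub>m b)" if "g < a * a" for g
  proof -
    have "g * (b * b) < a * a * (b * b)" using that pos by simp
    then show "\<kappa> g < ?d * ?d" by (simp add: \<kappa>_def mult_ac)
    show "\<sigma> (\<kappa> g) = kron (\<tau> g) (1\<^sub>m b)"
      using pos by (simp add: \<kappa>_def \<sigma>_def u.zero)
  qed
  let ?r = "complex_of_real (1 / sqrt a)"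
  have rr: "?r * ?r = 1 / of_nat a" by (rule t.sqrt_mult_self)
  define M1 where "M1 = (\<lambda>k. seq_op D 1 (P (\<kappa> (k div K)) (k mod K)) (send_op a (\<tau> (k div K))))"
  define N1 where "N1 = (\<lambda>l. seq_op D ?d (Q (l mod L)) (append_op b))"
  define M where "M = (\<lambda>k. seq_op a 1 output_op (M1 k))"
  define N where "N = (\<lambda>l. seq_op a ?d (send_first_op a b (\<tau> (l mod (a * a)))) (N1 (l div (a * a))))"
  \<comment> \<open>The teleportations of \<open>A\<close> to Bob and back contribute
    \<open>1 / sqrt a\<close> each.\<close>
  define c' where "c' = (\<lambda>k l. c (\<kappa> (k div K)) (k mod K) (l div (a * a)) / of_nat a)"
  have M1: "instrument a 1 (a * D) (a * a * K) M1"
    unfolding M1_def by (rule instrument_seq[OF t.instrument_send P[OF \<kappa>(1)]])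
  have iM: "instrument a a (a * D * a) (a * a * K) M"
    using instrument_seq[OF M1 instrument_output] by (simp add: M_def)
  have N1: "instrument b ?d (a * D) L N1"
    using instrument_seq[OF instrument_append[of b a] Q] by (simp add: N1_def)
  have iN: "instrument b b (a * D * a) (L * (a * a)) N"
    unfolding N_def by (rule instrument_seq[OF N1 t.instrument_send_first])
  have J: "c' k l = 0 \<or> (\<exists>g f f'. g < a * a \<and> f < a * a \<and> f' < b * b \<and>
      joint_op a a b b (a * D * a) (M k) (N l) = c' k l \<cdot>\<^sub>m (kron (\<tau> g * \<tau> f) (\<upsilon> f') * U))"
    if kl: "k < a * a * K" "l < L * (a * a)" for k l
  proof -
    note k = div_mod_less[OF kl(1)] and l = div_mod_less[OF kl(2)]
    let ?g = "k div K" and ?g' = "l mod (a * a)" and ?\<beta> = "l div (a * a)"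
    let ?C = "s.collapse D (P (\<kappa> ?g) (k mod K)) (Q ?\<beta>)"
    have "s.heralds U (c (\<kappa> ?g) (k mod K) ?\<beta>) (?C * \<sigma> (\<kappa> ?g))"
      by (rule h[OF \<kappa>(1)[OF k(1)] k(2) l(1)])
    then consider "c (\<kappa> ?g) (k mod K) ?\<beta> = 0"
      | f where "f < ?d * ?d" "?C * \<sigma> (\<kappa> ?g) = c (\<kappa> ?g) (k mod K) ?\<beta> \<cdot>\<^sub>m (\<sigma> f * U)"
      unfolding s.heralds_def by blast
    then show ?thesis
    proof cases
      case 1
      then show ?thesis by (simp add: c'_def)
    next
      case 2
      let ?f = "f div (b * b)" and ?f' = "f mod (b * b)"
      let ?c = "c (\<kappa> ?g) (k mod K) ?\<beta>"
      have "f < a * a * (b * b)" using 2(1) by (simp add: mult_ac)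
      note f = div_mod_less[OF this]
      let ?E = "kron (\<tau> ?g') (1\<^sub>m b)"
      have E: "?E \<in> carrier_mat ?d ?d" using t.carrier[OF l(2)] by auto
      note cs = s.carrier[OF \<kappa>(1)[OF k(1)]]
      note cf = s.carrier[OF 2(1)]
      have cC: "?C \<in> carrier_mat ?d ?d" by (rule s.collapse_carrier)
      have "joint_op a a b b (a * D * a) (M k) (N l) =
          joint_op 1 a ?d b a output_op (send_first_op a b (\<tau> ?g')) *
          (joint_op 1 1 ?d ?d D (P (\<kappa> ?g) (k mod K)) (Q ?\<beta>) *
           joint_op a 1 b ?d a (send_op a (\<tau> ?g)) (append_op b))"
        unfolding M_def N_def M1_def N1_def joint_op_seq using l(1) by simp
      also have "\<dots> = (?r \<cdot>\<^sub>m ?E) * (?C * (?r \<cdot>\<^sub>m \<sigma> (\<kappa> ?g)))"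
        unfolding joint_op_send[OF t.carrier[OF k(1)]] joint_op_send_first[OF t.carrier[OF l(2)]]
          \<kappa>(2)[OF k(1)] s.collapse_def ..
      also have "\<dots> = (?r * ?r) \<cdot>\<^sub>m (?E * (?C * \<sigma> (\<kappa> ?g)))"
        unfolding mult_smult_distrib[OF cC cs]
          mult_smult_assoc_mat[OF E smult_carrier_mat[OF mult_carrier_mat[OF cC cs]]]
          mult_smult_distrib[OF E mult_carrier_mat[OF cC cs]] smult_smult_mat_assoc ..
      also have "\<dots> = c' k l \<cdot>\<^sub>m (?E * (\<sigma> f * U))"
        unfolding 2(2) mult_smult_distrib[OF E mult_carrier_mat[OF cf U]] smult_smult_mat_assoc rr
        by (simp add: c'_def)
      also have "?E * (\<sigma> f * U) = kron (\<tau> ?g' * \<tau> ?f) (\<upsilon> ?f') * U"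
      proof -
        have "?E * (\<sigma> f * U) = ?E * \<sigma> f * U" by (rule assoc_mult_mat[symmetric, OF E cf U])
        also have "?E * \<sigma> f = kron (\<tau> ?g' * \<tau> ?f) (1\<^sub>m b * \<upsilon> ?f')"
          unfolding \<sigma>_def by (rule kron_mult[OF t.carrier[OF l(2)] t.carrier[OF f(1)] one_carrier_mat u.carrier[OF f(2)]])
        also have "1\<^sub>m b * \<upsilon> ?f' = \<upsilon> ?f'" by (rule left_mult_one_mat[OF u.carrier[OF f(2)]])
        finally show ?thesis .
      qed
      finally show ?thesis using l(2) f by blast
    qed
  qed
  \<comment> \<open>The bound on the middle part holds for each of the \<open>a * a\<close> initial
    keys; the \<open>a * a\<close> outcomes of Bob's final measurement cancel the weight
    1/a^2.\<close>
  have "real (a * D * a) * (1 - \<epsilon>) = (\<Sum>g<a * a. real D * (1 - \<epsilon>))" by simp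
  also have "\<dots> \<le> (\<Sum>g<a * a. \<Sum>\<alpha><K. \<Sum>\<beta><L. (norm (c (\<kappa> g) \<alpha> \<beta>))\<^sup>2)"
    using bd \<kappa>(1) by (intro sum_mono) simp
  also have "\<dots> = (\<Sum>g<a * a. \<Sum>\<alpha><K. \<Sum>\<beta><L. \<Sum>g'<a * a. (norm (c (\<kappa> g) \<alpha> \<beta> / of_nat a))\<^sup>2)"
    using pos by (intro sum.cong refl) (simp add: norm_divide power_divide power2_eq_square)
  also have "\<dots> = (\<Sum>k<a * a * K. \<Sum>l<L * (a * a). (norm (c' k l))\<^sup>2)"
    unfolding sum_prod_index[of _ "a * a" K] sum_prod_index[of _ L "a * a"]
    by (intro sum.cong refl) (simp add: c'_def)
  finally show ?thesis using iM iN J by blast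
qed

section \<open>Global phases and the final assembly\<close>

lemma joint_op_scale: "joint_op a a' b b' D (\<lambda>x u s. w * P x u s) Q = w \<cdot>\<^sub>m joint_op a a' b b' D P Q"
  by (rule eq_matI) (simp_all add: joint_op_def sum_distrib_left mult.assoc)

lemma instrument_scale:
  assumes "instrument a a' D K P" "norm w = 1"
  shows "instrument a a' D K (\<lambda>k x u s. w * P k x u s)"
proof -
  have "cnj w * w = 1" using assms(2) complex_norm_square[of w] by (simp add: mult.commute)
  then have "cnj (w * p) * (w * q) = cnj p * q" for p q
    by (metis complex_cnj_mult mult.assoc mult.left_commute mult_1)
  then show ?thesis using assms(1) unfolding instrument_def by (simp only:)
qed

theorem theorem4p1:
  fixes nA nB :: nat and U :: "complex mat" and \<epsilon> :: real
  assumes "unitary_mat (2 ^ nA * 2 ^ nB) U" and "\<epsilon> > 0"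
  shows "\<exists>m\<^sub>0. \<forall>m \<ge> m\<^sub>0. \<exists>K L (M :: nat \<Rightarrow> complex mat) (N :: nat \<Rightarrow> complex mat)
      (VA :: nat \<Rightarrow> nat \<Rightarrow> complex mat) (VB :: nat \<Rightarrow> nat \<Rightarrow> complex mat).
    local_operation nA m K M \<and> local_operation nB m L N \<and>
    (\<forall>k<K. \<forall>l<L. qubitwise_unitary nA (VA k l) \<and> qubitwise_unitary nB (VB k l)) \<and>
    (\<forall>\<psi> :: 'e::complex_hilbert vec. is_state (2 ^ nA * 2 ^ nB) \<psi> \<longrightarrow>
      (\<Sum>(k, l) \<in> {(k, l). k < K \<and> l < L \<and>
           act U \<psi> \<noteq> act (kron (VA k l) (VB k l)) (output_state nA nB m (M k) (N l) \<psi>)}.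
         output_prob nA nB m (M k) (N l) \<psi>) \<le> \<epsilon>)"
proof (cases "nA + nB = 0")
  \<comment> \<open>Without qubits \<open>U\<close> is a phase and the corrections are
    \<open>1\<^sub>m 1\<close>, so the phase has to come from Alice's Kraus operators.\<close>
  case True
  then have n [simp]: "nA = 0" "nB = 0" by simp_all
  let ?w = "U $$ (0, 0)"
  have U1: "U \<in> carrier_mat 1 1" "mat_adjoint U * U = 1\<^sub>m 1"
    using assms(1) by (simp_all add: unitary_mat_def)
  have U: "U = ?w \<cdot>\<^sub>m 1\<^sub>m 1"
    using U1(1) by (intro eq_matI) auto
  have "cnj ?w * ?w = (mat_adjoint U * U) $$ (0, 0)"
    using mult_mat_index[of "mat_adjoint U" 1 1 U 1 0 0] mat_adjoint_index[OF U1(1), of 0 0] U1(1) by simp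
  also have "\<dots> = 1" using U1(2) by simp
  finally have "(norm ?w)\<^sup>2 = 1"
    by (metis complex_norm_square mult.commute of_real_eq_1_iff)
  then have w: "norm ?w = 1" by (simp add: power2_eq_1_iff) (use norm_ge_zero[of ?w] in linarith)
  have *: "kron (1\<^sub>m 1) (1\<^sub>m 1) * joint_op 1 1 1 1 (2 ^ m) (\<lambda>x u s. ?w * measure_op k x u s) (measure_op l) =
      complex_of_real (of_bool (k = l)) \<cdot>\<^sub>m U" if "l < 2 ^ m" "k = l" for m k l
    using that U unfolding joint_op_scale joint_op_measure[OF that(1)] kron_one
    by (simp add: measure_op_def one_smult_mat left_mult_one_mat[OF U1(1), unfolded One_nat_def])
  show ?thesis
  proof (rule exI[of _ 0], intro allI impI, goal_cases)
    case (1 m)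
    show ?case
    \<comment> \<open>Both sides just measure all their halves, for any number of pairs. Only equal
      outcomes occur, and each of these succeeds.\<close>
    proof (rule instantaneous_protocol[OF assms(1), where c = "\<lambda>k l. of_bool (k = l)"])
      show "instrument (2 ^ nA) (2 ^ nA) (2 ^ m) (2 ^ m) (\<lambda>k x u s. ?w * measure_op k x u s)"
        by (rule instrument_scale[OF instrument_measure w])
      show "instrument (2 ^ nB) (2 ^ nB) (2 ^ m) (2 ^ m) measure_op"
        by (rule instrument_measure)
      show "\<exists>VA VB. qubitwise_unitary nA VA \<and> qubitwise_unitary nB VB \<and>
          kron VA VB * joint_op (2 ^ nA) (2 ^ nA) (2 ^ nB) (2 ^ nB) (2 ^ m) (\<lambda>x u s. ?w * measure_op k x u s) (measure_op l) =
          complex_of_real (of_bool (k = l)) \<cdot>\<^sub>m U"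
        if "k < 2 ^ m" "l < 2 ^ m" "of_bool (k = l) \<noteq> (0::real)" for k l
        using *[OF that(2)] that(3) by (intro exI[of _ "1\<^sub>m 1"]) (auto simp: qubitwise_unitary_0)
      have "(\<Sum>k<2 ^ m::nat. \<Sum>l<2 ^ m. (of_bool (k = l))\<^sup>2 :: real) = (\<Sum>k<2 ^ m::nat. 1)"
        by (intro sum.cong refl) (simp add: of_bool_def if_distrib[of "\<lambda>x. x ^ 2"] cong: if_cong)
      then show "2 ^ m * (1 - \<epsilon>) \<le> (\<Sum>k<2 ^ m::nat. \<Sum>l<2 ^ m::nat. (of_bool (k = l))\<^sup>2)"
        using assms(2) by simp
    qed simp
  qed
next
  case False
  let ?a = "2 ^ nA :: nat" and ?b = "2 ^ nB :: nat"
  let ?d = "?a * ?b"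
  let ?\<tau> = "qubit_pauli nA" and ?\<upsilon> = "qubit_pauli nB"
  let ?\<sigma> = "\<lambda>k. kron (?\<tau> (k div (?b * ?b))) (?\<upsilon> (k mod (?b * ?b)))"
  interpret s: error_basis ?d ?\<sigma>
    by (rule error_basis_kron[OF error_basis_qubit_pauli error_basis_qubit_pauli])
  have "real 1 \<le> real (?d * ?d)"
    unfolding of_nat_le_iff by (simp add: Suc_le_eq)
  moreover have "1 - 1 / x < 1" if "real 1 \<le> x" for x
    using that by simp
  ultimately have q: "1 - 1 / real (?d * ?d) < 1" by blast
  then obtain r where r: "(1 - 1 / real (?d * ?d)) ^ r < \<epsilon>"
    using real_arch_pow_inv[OF assms(2) q] by blast
  let ?\<delta> = "(1 - 1 / real (?d * ?d)) ^ r"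
  obtain e where e: "s.achievable {U} ?\<delta> e"
    using s.achievable_unitary[of "nA + nB" U r] assms(1) by (auto simp: power_add)
  show ?thesis
  \<comment> \<open>The outer \<open>nA\<close> pairs carry \<open>A\<close> to Bob and back;
    \<open>e\<close> pairs suffice to apply \<open>U\<close>.\<close>
  proof (rule exI[of _ "nA + e + nA"], intro allI impI, goal_cases)
    case m: (1 m)
    \<comment> \<open>All surplus pairs go to the middle batch, so that exactly \<open>m\<close>
      pairs are consumed.\<close>
    define j where "j = m - (nA + nA)"
    have j: "e \<le> j" "?a * 2 ^ j * ?a = 2 ^ m"
      using m by (simp_all add: j_def power_add[symmetric])
    obtain K P L where P: "\<And>k. k < ?d * ?d \<Longrightarrow> instrument 1 1 (2 ^ j) K (P k)"
      and ach: "s.achieves U (2 ^ j) K P L ?\<delta>"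
      using s.achievable_mono[OF e j(1)] unfolding s.achievable_def by blast
    have pos: "?a > 0" "?b > 0" by simp_all
    note bp = bipartite_protocol[OF error_basis_qubit_pauli error_basis_qubit_pauli pos
        unitary_mat_carrier[OF assms(1)] P ach, unfolded j(2)]
    obtain K L M N and c :: "nat \<Rightarrow> nat \<Rightarrow> complex" where MN: "instrument ?a ?a (2 ^ m) K M" "instrument ?b ?b (2 ^ m) L N"
      and c: "\<And>k l. k < K \<Longrightarrow> l < L \<Longrightarrow> c k l = 0 \<or> (\<exists>g f f'. g < ?a * ?a \<and> f < ?a * ?a \<and> f' < ?b * ?b \<and>
        joint_op ?a ?a ?b ?b (2 ^ m) (M k) (N l) = c k l \<cdot>\<^sub>m (kron (?\<tau> g * ?\<tau> f) (?\<upsilon> f') * U))"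
      and bd: "real (2 ^ m) * (1 - ?\<delta>) \<le> (\<Sum>k<K. \<Sum>l<L. (norm (c k l))\<^sup>2)"
      using bp by blast
    show ?case
    proof (rule instantaneous_protocol[OF assms(1) MN, where c = "\<lambda>k l. norm (c k l)"])
      fix k l assume kl: "k < K" "l < L" and nz: "norm (c k l) \<noteq> 0"
      then obtain g f f' where gf: "g < ?a * ?a" "f < ?a * ?a" "f' < ?b * ?b"
        "joint_op ?a ?a ?b ?b (2 ^ m) (M k) (N l) = c k l \<cdot>\<^sub>m (kron (?\<tau> g * ?\<tau> f) (?\<upsilon> f') * U)"
        using c[OF kl] by auto
      show "\<exists>VA VB. qubitwise_unitary nA VA \<and> qubitwise_unitary nB VB \<and>
          kron VA VB * joint_op ?a ?a ?b ?b (2 ^ m) (M k) (N l) = complex_of_real (norm (c k l)) \<cdot>\<^sub>m U"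
        unfolding gf(4)
      proof (rule qubitwise_unitary_correction)
        show "qubitwise_unitary nA (?\<tau> g * ?\<tau> f)"
          using gf by (intro qubitwise_unitary_mult qubitwise_unitary_qubit_pauli)
        show "qubitwise_unitary nB (?\<upsilon> f')"
          using gf by (intro qubitwise_unitary_qubit_pauli)
        show "c k l \<noteq> 0" using nz by simp
        show "nA + nB > 0" using False by simp
        show "U \<in> carrier_mat ?d ?d" by (rule unitary_mat_carrier[OF assms(1)])
      qed
    next
      have "1 - \<epsilon> \<le> 1 - ?\<delta>" using r by linarith
      then have "real (2 ^ m) * (1 - \<epsilon>) \<le> real (2 ^ m) * (1 - ?\<delta>)" by (rule mult_left_mono) simp
      also note bd
      finally show "2 ^ m * (1 - \<epsilon>) \<le> (\<Sum>k<K. \<Sum>l<L. (norm (c k l))\<^sup>2)"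
        by (simp only: of_nat_power of_nat_numeral)
    qed simp
  qed
qed

end
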